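(* The MES rule described in the context is a polynomial-time semi-online rule that satisfies rank-wPJR (that is, on every input its output satisfies rank-wPJR).
   Context: Model. Voters $V=[n]$, a set $C$ of $m$ candidates, rounds $T=\{1,\dots,|T|\}$ with $n,m,|T|\ge1$; $|T|$ is the horizon. In each round $j$ each voter $i$ has a strict complete ranking of $C$; $P^j$ denotes the tuple of round-$j$ rankings. For $r\in[m]$, $A_i^j(r)$ is the set of voter $i$'s $r$ most-preferred candidates in round $j$, and $N_c^j(r)=\{i\in V:c\in A_i^j(r)\}$. A sequence is $W=(w^1,\dots,w^{|T|})\in C^{|T|}$. A group is a nonempty $S\subseteq V$. A rule is semi-online if, for every $j$, its choice of $w^j$ depends only on $P^1,\dots,P^j$ and $|T|$ (besides $V$ and $C$). Rank-wPJR. $W$ satisfies rank-wPJR if, for every rank vector $\mathbf r=(r^1,\dots,r^{|T|})\in[m]^{|T|}$, every positive integer $\ell$, and every group $S$ with $|S|\ge\ell n/|T|$ such that $\bigcap_{i\in S}A_i^j(r^j)\ne\varnothing$ for all $j\in T$, there are at least $\ell$ rounds $j\in T$ with $w^j\in\bigcup_{i\in S}A_i^j(r^j)$. MES rule. Each voter starts with budget $b_i=|T|/n$. For $\rho>0$ and given current budgets, candidate $c$ is $\rho$-affordable at cutoff $r$ in round $j$ if $\sum_{i\in N_c^j(r)}\min\{\rho,b_i\}=1$. In each round $j=1,\dots,|T|$: find the smallest $r\in[m]$ for which the set $X=\{c\in C:\sum_{i\in N_c^j(r)}b_i\ge1\}$ is nonempty; for this $r$, select as $w^j$ a candidate $c\in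 X$ that is $\rho$-affordable for the lowest $\rho$ (ties broken by a fixed order); then replace $b_i$ by $b_i-\min\{\rho,b_i\}$ for every $i\in N_{w^j}^j(r)$. *)

theory Defs
  imports Complex_Main "HOL-Library.Log_Nat" "HOL-Computational_Algebra.Polynomial"
begin

text \<open>
  Voters are \<open>0, \<dots>, n - 1\<close> and rounds are \<open>0, \<dots>, T - 1\<close>. A ranking is the list of the
  candidates from most to least preferred; \<open>pref E j i\<close> is the ranking of voter \<open>i\<close> in round \<open>j\<close>
  and is meaningful only for \<open>j < horizon E\<close> and \<open>i < num_voters E\<close>.
\<close>

record 'c election =
  num_voters :: nat
  cands :: "'c set"
  horizon :: nat
  pref :: "nat \<Rightarrow> nat \<Rightarrow> 'c list"

definition voters :: "'c election \<Rightarrow> nat set" where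
  "voters E = {..<num_voters E}"

definition rounds :: "'c election \<Rightarrow> nat set" where
  "rounds E = {..<horizon E}"

definition valid_election :: "'c election \<Rightarrow> bool" where
  "valid_election E \<longleftrightarrow>
     num_voters E \<ge> 1 \<and> finite (cands E) \<and> cands E \<noteq> {} \<and> horizon E \<ge> 1 \<and>
     (\<forall>j\<in>rounds E. \<forall>i\<in>voters E. distinct (pref E j i) \<and> set (pref E j i) = cands E)"

definition top_set :: "'c election \<Rightarrow> nat \<Rightarrow> nat \<Rightarrow> nat \<Rightarrow> 'c set" where
  "top_set E j i r = set (take r (pref E j i))"

definition supporters :: "'c election \<Rightarrow> nat \<Rightarrow> 'c \<Rightarrow> nat \<Rightarrow> nat set" where
  "supporters E j c r = {i \<in> voters E. c \<in> top_set E j i r}"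

definition sequences :: "'c election \<Rightarrow> 'c list set" where
  "sequences E = {W. length W = horizon E \<and> set W \<subseteq> cands E}"


section \<open>Rank-wPJR\<close>

definition rank_wPJR :: "'c election \<Rightarrow> 'c list \<Rightarrow> bool" where
  "rank_wPJR E W \<longleftrightarrow>
     (\<forall>(r :: nat \<Rightarrow> nat) (l :: nat) S.
        (\<forall>j\<in>rounds E. r j \<in> {1..card (cands E)}) \<longrightarrow>
        l \<ge> 1 \<longrightarrow>
        S \<noteq> {} \<longrightarrow> S \<subseteq> voters E \<longrightarrow>
        real (card S) \<ge> real l * real (num_voters E) / real (horizon E) \<longrightarrow>
        (\<forall>j\<in>rounds E. (\<Inter>i\<in>S. top_set E j i (r j)) \<noteq> {}) \<longrightarrow>
        card {j \<in> rounds E. W ! j \<in> (\<Union>i\<in>S. top_set E j i (r j))} \<ge> l)"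


section \<open>Semi-online rules\<close>

type_synonym 'c rule = "'c election \<Rightarrow> 'c list"

definition semi_online :: "'c rule \<Rightarrow> bool" where
  "semi_online f \<longleftrightarrow>
     (\<forall>E. valid_election E \<longrightarrow> f E \<in> sequences E) \<and>
     (\<forall>E E' j. valid_election E \<longrightarrow> valid_election E' \<longrightarrow>
        num_voters E = num_voters E' \<longrightarrow> cands E = cands E' \<longrightarrow> horizon E = horizon E' \<longrightarrow>
        j \<in> rounds E \<longrightarrow>
        (\<forall>k\<le>j. \<forall>i\<in>voters E. pref E k i = pref E' k i) \<longrightarrow>
        f E ! j = f E' ! j)"


section \<open>The MES rule\<close>

definition affordable ::
  "'c election \<Rightarrow> nat \<Rightarrow> (nat \<Rightarrow> real) \<Rightarrow> nat \<Rightarrow> real \<Rightarrow> 'c \<Rightarrow> bool" where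
  "affordable E j b r \<rho> c \<longleftrightarrow> \<rho> > 0 \<and> (\<Sum>i\<in>supporters E j c r. min \<rho> (b i)) = 1"

definition purchasable :: "'c election \<Rightarrow> nat \<Rightarrow> (nat \<Rightarrow> real) \<Rightarrow> nat \<Rightarrow> 'c set" where
  "purchasable E j b r = {c \<in> cands E. (\<Sum>i\<in>supporters E j c r. b i) \<ge> 1}"

text \<open>
  \<open>mes_round tie E j b c b'\<close>: in round \<open>j\<close>, started with budgets \<open>b\<close>, the rule selects \<open>c\<close> and
  leaves the budgets \<open>b'\<close>. The reflexive linear order \<open>tie\<close> breaks ties, its smaller elements
  being preferred.
\<close>

definition mes_round ::
  "'c rel \<Rightarrow> 'c election \<Rightarrow> nat \<Rightarrow> (nat \<Rightarrow> real) \<Rightarrow> 'c \<Rightarrow> (nat \<Rightarrow> real) \<Rightarrow> bool" where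
  "mes_round tie E j b c b' \<longleftrightarrow>
     (\<exists>r \<rho>. r \<in> {1..card (cands E)} \<and>
        purchasable E j b r \<noteq> {} \<and>
        (\<forall>r'\<in>{1..<r}. purchasable E j b r' = {}) \<and>
        c \<in> purchasable E j b r \<and> affordable E j b r \<rho> c \<and>
        (\<forall>c'\<in>purchasable E j b r. \<forall>\<rho>'. affordable E j b r \<rho>' c' \<longrightarrow> \<rho> \<le> \<rho>') \<and>
        (\<forall>c'\<in>purchasable E j b r. affordable E j b r \<rho> c' \<longrightarrow> (c, c') \<in> tie) \<and>
        b' = (\<lambda>i. if i \<in> supporters E j c r then b i - min \<rho> (b i) else b i))"

definition mes_outcome :: "'c rel \<Rightarrow> 'c election \<Rightarrow> 'c list \<Rightarrow> bool" where
  "mes_outcome tie E W \<longleftrightarrow>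
     length W = horizon E \<and>
     (\<exists>b :: nat \<Rightarrow> nat \<Rightarrow> real.
        b 0 = (\<lambda>i. real (horizon E) / real (num_voters E)) \<and>
        (\<forall>j\<in>rounds E. mes_round tie E j (b j) (W ! j) (b (Suc j))))"

definition mes :: "'c rel \<Rightarrow> 'c rule" where
  "mes tie E = (THE W. mes_outcome tie E W)"


section \<open>Polynomial time\<close>

text \<open>
  The machine model is the random access machine with addition and truncated subtraction under
  the logarithmic cost criterion (Cook and Reckhow), in structured form: every instruction is
  charged the binary lengths of the operands and of the memory addresses it handles. It is
  polynomially equivalent to Turing machines. A state consists of the registers, which a program
  addresses by constants, and of the memory, which it addresses indirectly.
\<close>

datatype ram =
    Skip
  | Const nat nat       \<comment> \<open>\<open>Const x k\<close>: \<open>R x := k\<close>\<close>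
  | Add nat nat nat     \<comment> \<open>\<open>Add x y z\<close>: \<open>R x := R y + R z\<close>\<close>
  | Sub nat nat nat     \<comment> \<open>\<open>Sub x y z\<close>: \<open>R x := R y - R z\<close>, or 0 if this is negative\<close>
  | Load nat nat        \<comment> \<open>\<open>Load x y\<close>: \<open>R x := M (R y)\<close>\<close>
  | Store nat nat       \<comment> \<open>\<open>Store x y\<close>: \<open>M (R x) := R y\<close>\<close>
  | Seq ram ram
  | If nat ram ram      \<comment> \<open>\<open>If x p q\<close>: \<open>p\<close> if \<open>R x \<noteq> 0\<close>, otherwise \<open>q\<close>\<close>
  | While nat ram       \<comment> \<open>\<open>While x p\<close>: repeat \<open>p\<close> as long as \<open>R x \<noteq> 0\<close>\<close>

type_synonym ram_state = "(nat \<Rightarrow> nat) \<times> (nat \<Rightarrow> nat)"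

abbreviation bits :: "nat \<Rightarrow> nat" where
  "bits k \<equiv> floorlog 2 k"

text \<open>\<open>exec p s t s'\<close>: started in state \<open>s\<close>, the program \<open>p\<close> halts in state \<open>s'\<close> at cost \<open>t\<close>.\<close>

inductive exec :: "ram \<Rightarrow> ram_state \<Rightarrow> nat \<Rightarrow> ram_state \<Rightarrow> bool" where
  Skip: "exec Skip s 1 s"
| Const: "exec (Const x k) (R, M) (1 + bits k) (R(x := k), M)"
| Add: "exec (Add x y z) (R, M) (1 + bits (R y) + bits (R z)) (R(x := R y + R z), M)"
| Sub: "exec (Sub x y z) (R, M) (1 + bits (R y) + bits (R z)) (R(x := R y - R z), M)"
| Load: "exec (Load x y) (R, M) (1 + bits (R y) + bits (M (R y))) (R(x := M (R y)), M)"
| Store: "exec (Store x y) (R, M) (1 + bits (R x) + bits (R y)) (R, M(R x := R y))"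
| Seq: "exec p s t s' \<Longrightarrow> exec q s' u s'' \<Longrightarrow> exec (Seq p q) s (t + u) s''"
| IfTrue: "R x \<noteq> 0 \<Longrightarrow> exec p (R, M) t s' \<Longrightarrow> exec (If x p q) (R, M) (1 + bits (R x) + t) s'"
| IfFalse: "R x = 0 \<Longrightarrow> exec q (R, M) t s' \<Longrightarrow> exec (If x p q) (R, M) (1 + t) s'"
| WhileTrue: "R x \<noteq> 0 \<Longrightarrow> exec p (R, M) t s' \<Longrightarrow> exec (While x p) s' u s'' \<Longrightarrow>
    exec (While x p) (R, M) (1 + bits (R x) + t + u) s''"
| WhileFalse: "R x = 0 \<Longrightarrow> exec (While x p) (R, M) 1 (R, M)"

text \<open>
  A word sequence is passed to and returned by a program in the memory cells from address 0 on,
  with its length in register 0. Initially everything else is 0.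
\<close>

definition input_state :: "nat list \<Rightarrow> ram_state" where
  "input_state xs =
     ((\<lambda>x. 0)(0 := length xs), (\<lambda>a. if a < length xs then xs ! a else 0))"

definition output_of :: "ram_state \<Rightarrow> nat list" where
  "output_of s = map (snd s) [0..<fst s 0]"

definition input_size :: "nat list \<Rightarrow> nat" where
  "input_size xs = (\<Sum>x\<leftarrow>xs. 1 + bits x)"

definition polytime_computable :: "(nat list \<times> nat list) set \<Rightarrow> bool" where
  "polytime_computable F \<longleftrightarrow>
     (\<exists>p (q :: nat poly). \<forall>(xs, ys)\<in>F.
        \<exists>t s. exec p (input_state xs) t s \<and> output_of s = ys \<and> t \<le> poly q (input_size xs))"

text \<open>
  An instance is given to a program by \<open>n\<close>, \<open>m\<close>, \<open>T\<close>, the tie-breaking order on the candidates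
  (as the list \<open>cs\<close>), and all rankings. Candidates are named by the numbers below \<open>m\<close>, and the
  program has to cope with every such naming \<open>\<nu>\<close>.
\<close>

definition encode :: "('c \<Rightarrow> nat) \<Rightarrow> 'c list \<Rightarrow> 'c election \<Rightarrow> nat list" where
  "encode \<nu> cs E =
     [num_voters E, card (cands E), horizon E] @ map \<nu> cs @
     concat (map (\<lambda>j. concat (map (\<lambda>i. map \<nu> (pref E j i)) [0..<num_voters E])) [0..<horizon E])"

definition lists_in_order :: "'c rel \<Rightarrow> 'c set \<Rightarrow> 'c list \<Rightarrow> bool" where
  "lists_in_order tie C cs \<longleftrightarrow>
     distinct cs \<and> set cs = C \<and> sorted_wrt (\<lambda>c c'. (c, c') \<in> tie) cs"

definition polynomial_time :: "'c rel \<Rightarrow> 'c rule \<Rightarrow> bool" where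
  "polynomial_time tie f \<longleftrightarrow>
     polytime_computable
       {(encode \<nu> cs E, map \<nu> (f E)) | \<nu> cs E.
          valid_election E \<and> lists_in_order tie (cands E) cs \<and>
          bij_betw \<nu> (cands E) {..<card (cands E)}}"

end

(*
  rank-wPJR: a group of l n / T voters starts with a total budget of at least l. While it holds at
  least 1 it could buy one of its common candidates at cutoff r_j, so the cutoff used by the rule is
  at most r_j, and the group pays nothing unless the winner is in the union of its top sets. As a
  round costs the group at most 1 and all budgets are spent in the end, there are l such rounds.

  Polynomial time: the lowest price rho of a candidate solves sum_i min(rho, b_i) = 1. A supporter s
  has b_s < rho iff sum_i min(b_s, b_i) < 1, so rho = (1 - sum of these b_s) / (number of the other
  supporters). With a common denominator D for the budgets, every round is therefore computed by
  bounded sums of integers, D being multiplied by a number of at most n. Such bounded sums are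
  compiled to the machine. Its values grow by at most one bit per instruction, so a polynomial number
  of instructions entails a polynomial logarithmic cost.
*)
theory Submission
  imports Defs
begin

section \<open>Bounded sums and loops on the random access machine\<close>

text \<open>The polynomial bound must not rest on estimates of the numbers computed. It is therefore
  read off the syntax of the program: loops are bounded by \<open>n\<close>, \<open>m\<close>,
  \<open>T\<close> and loop variables, never by computed values, so the number of instructions is
  polynomial in the input length whatever the memory contains. This restriction shapes the
  arithmetic. Repeated addition cannot multiply two large numbers, so every product with a budget or
  a price numerator needs a factor of at most \<open>n\<close>. The counts of supporters who are not
  poor supply it, both when two prices are compared by cross-multiplication and when the budgets are
  brought to their next denominator. Nor are budgets sorted: whether a supporter is poor is decided
  by a sum of its own, and this selects the linear piece of the piecewise linear equation for the
  price. The group argument needs that the winner collects exactly 1 in every round. The total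
  budget is then \<open>T - j\<close> before round \<open>j\<close>, which guarantees that something
  can be bought in each round and leaves 0 at the end, less than what a group with too few good
  rounds would still own.\<close>

lemma bits_le_iff: "bits x \<le> K \<longleftrightarrow> x < 2 ^ K"
proof
  assume "bits x \<le> K"
  show "x < 2 ^ K"
  proof (cases "x = 0")
    case False
    then have "x < 2 ^ bits x" using floorlog_bounds[of x 2] by simp
    also have "\<dots> \<le> 2 ^ K" using \<open>bits x \<le> K\<close> by (simp add: power_increasing)
    finally show ?thesis .
  qed simp
next
  assume "x < 2 ^ K"
  then show "bits x \<le> K" by (intro floorlog_leI) auto
qed

section \<open>Bit lengths and costs of machine programs\<close>

text \<open>Memory addresses need no bound of their own: the addresses that are charged are contents
  of registers.\<close>

definition fits :: "nat \<Rightarrow> ram_state \<Rightarrow> bool" where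
  "fits K s \<longleftrightarrow> (\<forall>x. fst s x < 2 ^ K \<and> snd s x < 2 ^ K)"

lemma fits_mono: "fits K s \<Longrightarrow> K \<le> K' \<Longrightarrow> fits K' s"
  unfolding fits_def by (meson less_le_trans one_le_numeral power_increasing)

lemma fits_bits: "fits K (R, M) \<Longrightarrow> bits (R x) \<le> K" "fits K (R, M) \<Longrightarrow> bits (M x) \<le> K"
  by (auto simp: fits_def bits_le_iff)

text \<open>
  The parameter \<open>k\<close> is a bound on the uniform cost. As an instruction lengthens the largest number
  by at most one bit, \<open>k\<close> also controls the logarithmic cost.
\<close>

definition runs :: "ram \<Rightarrow> ram_state \<Rightarrow> nat \<Rightarrow> ram_state \<Rightarrow> bool" where
  "runs p s k s' \<longleftrightarrow> (\<exists>t. exec p s t s' \<and>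
     (\<forall>K. fits K s \<longrightarrow> fits (K + k) s' \<and> t \<le> k * (2 * (K + k) + 1)))"

text \<open>A constant may be longer than every number present. Charging it by its length keeps the
  growth within one bit per unit of \<open>k\<close>.\<close>

lemma runs_Const: "runs (Const x c) (R, M) (Suc (bits c)) (R(x := c), M)"
proof -
  have "fits (K + Suc (bits c)) (R(x := c), M)" if "fits K (R, M)" for K
  proof -
    have "c < 2 ^ (K + Suc (bits c))"
      unfolding bits_le_iff[symmetric] by simp
    then show ?thesis using fits_mono[OF that, of "K + Suc (bits c)"] by (auto simp: fits_def)
  qed
  moreover have "1 + bits c \<le> Suc (bits c) * (2 * (K + Suc (bits c)) + 1)" for K
    by simp
  ultimately show ?thesis
    unfolding runs_def using exec.Const by blast
qed

lemma runs_Add: "runs (Add x y z) (R, M) 1 (R(x := R y + R z), M)"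
proof -
  have "fits (K + 1) (R(x := R y + R z), M)" if "fits K (R, M)" for K
  proof -
    have "R y < 2 ^ K" "R z < 2 ^ K" using that by (auto simp: fits_def)
    then have "R y + R z < 2 ^ (K + 1)" by simp
    then show ?thesis using fits_mono[OF that, of "K + 1"] by (auto simp: fits_def)
  qed
  moreover have "1 + bits (R y) + bits (R z) \<le> 1 * (2 * (K + 1) + 1)" if "fits K (R, M)" for K
    using fits_bits(1)[OF that, of y] fits_bits(1)[OF that, of z] by simp
  ultimately show ?thesis
    unfolding runs_def using exec.Add by blast
qed

lemma runs_Sub: "runs (Sub x y z) (R, M) 1 (R(x := R y - R z), M)"
proof -
  have "fits (K + 1) (R(x := R y - R z), M)" if "fits K (R, M)" for K
    using fits_mono[OF that, of "K + 1"] by (auto simp: fits_def intro: le_less_trans[OF diff_le_self])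
  moreover have "1 + bits (R y) + bits (R z) \<le> 1 * (2 * (K + 1) + 1)" if "fits K (R, M)" for K
    using fits_bits(1)[OF that, of y] fits_bits(1)[OF that, of z] by simp
  ultimately show ?thesis
    unfolding runs_def using exec.Sub by blast
qed

lemma runs_Load: "runs (Load x y) (R, M) 1 (R(x := M (R y)), M)"
proof -
  have "fits (K + 1) (R(x := M (R y)), M)" if "fits K (R, M)" for K
    using fits_mono[OF that, of "K + 1"] by (auto simp: fits_def)
  moreover have "1 + bits (R y) + bits (M (R y)) \<le> 1 * (2 * (K + 1) + 1)" if "fits K (R, M)" for K
    using fits_bits(1)[OF that, of y] fits_bits(2)[OF that, of "R y"] by simp
  ultimately show ?thesis
    unfolding runs_def using exec.Load by blast
qed

lemma runs_Store: "runs (Store x y) (R, M) 1 (R, M(R x := R y))"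
proof -
  have "fits (K + 1) (R, M(R x := R y))" if "fits K (R, M)" for K
    using fits_mono[OF that, of "K + 1"] by (auto simp: fits_def)
  moreover have "1 + bits (R x) + bits (R y) \<le> 1 * (2 * (K + 1) + 1)" if "fits K (R, M)" for K
    using fits_bits(1)[OF that, of x] fits_bits(1)[OF that, of y] by simp
  ultimately show ?thesis
    unfolding runs_def using exec.Store by blast
qed

text \<open>The second part starts with numbers that the first has lengthened to
  \<open>K + k1\<close> bits. Evaluating the bound at the final length pays for this, with
  \<open>2 * k1 * k2\<close> to spare.\<close>

lemma cost_superadditive:
  "k1 * (2 * (K + k1) + 1) + k2 * (2 * ((K + k1) + k2) + 1)
     \<le> (k1 + k2) * (2 * (K + (k1 + k2)) + (1 :: nat))"
  by (simp add: algebra_simps)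

lemma runs_Seq:
  assumes "runs p s k1 s'" "runs q s' k2 s''"
  shows "runs (Seq p q) s (k1 + k2) s''"
proof -
  obtain t u where t: "exec p s t s'" "exec q s' u s''"
    and *: "\<And>K. fits K s \<Longrightarrow> fits (K + k1) s' \<and> t \<le> k1 * (2 * (K + k1) + 1)"
      "\<And>K. fits K s' \<Longrightarrow> fits (K + k2) s'' \<and> u \<le> k2 * (2 * (K + k2) + 1)"
    using assms unfolding runs_def by blast
  have "fits (K + (k1 + k2)) s'' \<and> t + u \<le> (k1 + k2) * (2 * (K + (k1 + k2)) + 1)" if "fits K s" for K
    using *(1)[OF that] *(2)[of "K + k1"] cost_superadditive[of k1 K k2] by (force simp: add.assoc)
  then show ?thesis unfolding runs_def using exec.Seq[OF t] by blast
qed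

lemma runs_If:
  assumes "R x \<noteq> 0 \<Longrightarrow> runs p (R, M) k s'" "R x = 0 \<Longrightarrow> runs q (R, M) k s'"
  shows "runs (ram.If x p q) (R, M) (Suc k) s'"
proof -
  have "\<exists>t. exec (if R x \<noteq> 0 then p else q) (R, M) t s' \<and>
      (\<forall>K. fits K (R, M) \<longrightarrow> fits (K + k) s' \<and> t \<le> k * (2 * (K + k) + 1))"
    using assms unfolding runs_def by simp
  then obtain t where t: "exec (if R x \<noteq> 0 then p else q) (R, M) t s'"
    and *: "\<And>K. fits K (R, M) \<Longrightarrow> fits (K + k) s' \<and> t \<le> k * (2 * (K + k) + 1)"
    by blast
  \<comment> \<open>As \<open>bits 0 = 0\<close>, the cost formula of the true branch covers the
    false one as well.\<close>
  have ex: "exec (ram.If x p q) (R, M) (1 + bits (R x) + t) s'"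
    using t exec.IfTrue[of R x p M t s' q] exec.IfFalse[of R x q M t s' p]
    by (auto simp: floorlog_def split: if_splits)
  have "fits (K + Suc k) s' \<and> 1 + bits (R x) + t \<le> Suc k * (2 * (K + Suc k) + 1)"
    if K: "fits K (R, M)" for K
    using *[OF K] fits_bits(1)[OF K, of x] by (auto intro: fits_mono)
  then show ?thesis unfolding runs_def using ex by blast
qed

lemma runs_WhileFalse: "R x = 0 \<Longrightarrow> runs (While x p) (R, M) 1 (R, M)"
  unfolding runs_def
  by (intro exI[of _ 1] conjI exec.WhileFalse) (auto intro: fits_mono)

lemma runs_WhileTrue:
  assumes "R x \<noteq> 0" "runs p (R, M) k1 s'" "runs (While x p) s' k2 s''"
  shows "runs (While x p) (R, M) (Suc (k1 + k2)) s''"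
proof -
  obtain t u where t: "exec p (R, M) t s'" "exec (While x p) s' u s''"
    and *: "\<And>K. fits K (R, M) \<Longrightarrow> fits (K + k1) s' \<and> t \<le> k1 * (2 * (K + k1) + 1)"
      "\<And>K. fits K s' \<Longrightarrow> fits (K + k2) s'' \<and> u \<le> k2 * (2 * (K + k2) + 1)"
    using assms(2,3) unfolding runs_def by blast
  have "fits (K + Suc (k1 + k2)) s'' \<and>
      1 + bits (R x) + t + u \<le> Suc (k1 + k2) * (2 * (K + Suc (k1 + k2)) + 1)"
    if K: "fits K (R, M)" for K
  proof
    have s': "fits (K + k1) s'" "t \<le> k1 * (2 * (K + k1) + 1)" using *(1)[OF K] by auto
    have s'': "fits (K + k1 + k2) s''" "u \<le> k2 * (2 * (K + k1 + k2) + 1)" using *(2)[OF s'(1)] by auto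
    show "fits (K + Suc (k1 + k2)) s''" using s''(1) by (rule fits_mono) simp
    have "t + u \<le> (k1 + k2) * (2 * (K + (k1 + k2)) + 1)"
      using s'(2) s''(2) cost_superadditive[of k1 K k2] by linarith
    moreover have "1 + K + (k1 + k2) * (2 * (K + (k1 + k2)) + 1)
        \<le> Suc (k1 + k2) * (2 * (K + Suc (k1 + k2)) + 1)"
      by (simp add: algebra_simps)
    ultimately show "1 + bits (R x) + t + u \<le> Suc (k1 + k2) * (2 * (K + Suc (k1 + k2)) + 1)"
      using fits_bits(1)[OF K, of x] by linarith
  qed
  then show ?thesis unfolding runs_def using exec.WhileTrue[OF assms(1) t] by blast
qed

lemma runs_mono:
  assumes "runs p s k s'" "k \<le> k'"
  shows "runs p s k' s'"
proof -
  have "k * (2 * (K + k) + 1) \<le> k' * (2 * (K + k') + 1)" for K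
    using assms(2) by (intro mult_le_mono) auto
  then show ?thesis
    using assms unfolding runs_def by (meson add_le_cancel_left fits_mono le_trans)
qed

text \<open>Each iteration costs \<open>k\<close>, and 1 for the test before it; the outer
  \<open>Suc\<close> is the final, failing test.\<close>

lemma runs_countdown:
  assumes body: "\<And>i R M. i < N \<Longrightarrow> R x = N - i \<Longrightarrow> Inv i R M \<Longrightarrow>
      \<exists>R' M'. runs p (R, M) k (R', M') \<and> R' x = N - Suc i \<and> Inv (Suc i) R' M'"
    and "R x = N" "Inv 0 R M"
  shows "\<exists>R' M'. runs (While x p) (R, M) (Suc (N * Suc k)) (R', M') \<and> Inv N R' M'"
proof -
  \<comment> \<open>Induction on the number \<open>d\<close> of iterations that remain, which is the
    content of register \<open>x\<close>.\<close>
  have "\<exists>R' M'. runs (While x p) (R, M) (Suc (d * Suc k)) (R', M') \<and> Inv N R' M'"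
    if "d \<le> N" "R x = d" "Inv (N - d) R M" for d R M
    using that
  proof (induction d arbitrary: R M)
    case 0
    then show ?case using runs_WhileFalse[of R x p M] by auto
  next
    case (Suc d)
    then obtain R' M' where 1: "runs p (R, M) k (R', M')" "R' x = d" "Inv (N - d) R' M'"
      using body[of "N - Suc d" R M] by (auto simp: Suc_diff_Suc)
    then obtain R'' M'' where
      2: "runs (While x p) (R', M') (Suc (d * Suc k)) (R'', M'')" "Inv N R'' M''"
      using Suc.IH[of R' M'] Suc.prems by auto
    have "runs (While x p) (R, M) (Suc (k + Suc (d * Suc k))) (R'', M'')"
      using runs_WhileTrue[OF _ 1(1) 2(1)] Suc.prems by simp
    then show ?case using 2(2) by (auto simp: add_ac)
  qed
  from this[of N R M] show ?thesis using assms by auto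
qed

text \<open>Variables are de Bruijn indices: 0 is the innermost loop variable.\<close>

datatype expr =
    Var nat
  | Num nat
  | Plus expr expr
  | Minus expr expr
  | Cell expr
  | Cond expr expr expr
  | Sigma nat expr

text \<open>The first argument of \<open>For\<close>, like that of \<open>Sigma\<close>, is the
  index of a variable and not an expression: a bound read from memory could be exponential in the
  input size.\<close>

datatype cmd =
    Write expr expr
  | Then cmd cmd
  | For nat cmd

primrec val :: "expr \<Rightarrow> (nat \<Rightarrow> nat) \<Rightarrow> (nat \<Rightarrow> nat) \<Rightarrow> nat" where
  "val (Var k) \<sigma> M = \<sigma> k"
| "val (Num c) \<sigma> M = c"
| "val (Plus a b) \<sigma> M = val a \<sigma> M + val b \<sigma> M"
| "val (Minus a b) \<sigma> M = val a \<sigma> M - val b \<sigma> M"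
| "val (Cell a) \<sigma> M = M (val a \<sigma> M)"
| "val (Cond a b c) \<sigma> M = (if val a \<sigma> M \<noteq> 0 then val b \<sigma> M else val c \<sigma> M)"
| "val (Sigma y e) \<sigma> M = (\<Sum>i<\<sigma> y. val e (case_nat i \<sigma>) M)"

primrec effect :: "cmd \<Rightarrow> (nat \<Rightarrow> nat) \<Rightarrow> (nat \<Rightarrow> nat) \<Rightarrow> nat \<Rightarrow> nat" where
  "effect (Write a e) \<sigma> M = M(val a \<sigma> M := val e \<sigma> M)"
| "effect (Then c d) \<sigma> M = effect d \<sigma> (effect c \<sigma> M)"
| "effect (For y c) \<sigma> M = fold (\<lambda>i. effect c (case_nat i \<sigma>)) [0..<\<sigma> y] M"

text \<open>
  Variable \<open>k\<close> lives in register \<open>\<rho> k\<close>. The value of an expression is put into register \<open>t\<close>, and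
  the registers below \<open>t\<close> are left alone.
\<close>

primrec comp :: "expr \<Rightarrow> (nat \<Rightarrow> nat) \<Rightarrow> nat \<Rightarrow> ram" where
  "comp (Var k) \<rho> t = Seq (Const (t + 1) 0) (Add t (\<rho> k) (t + 1))"
| "comp (Num c) \<rho> t = Const t c"
| "comp (Plus a b) \<rho> t = Seq (comp a \<rho> t) (Seq (comp b \<rho> (t + 1)) (Add t t (t + 1)))"
| "comp (Minus a b) \<rho> t = Seq (comp a \<rho> t) (Seq (comp b \<rho> (t + 1)) (Sub t t (t + 1)))"
| "comp (Cell a) \<rho> t = Seq (comp a \<rho> t) (Load t t)"
| "comp (Cond a b c) \<rho> t = Seq (comp a \<rho> t) (ram.If t (comp b \<rho> t) (comp c \<rho> t))"
| "comp (Sigma y e) \<rho> t =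
     Seq (Const t 0) (Seq (Const (t + 1) 0) (Seq (Add (t + 2) (\<rho> y) (t + 1))
       (While (t + 2)
         (Seq (comp e (case_nat (t + 1) \<rho>) (t + 3)) (Seq (Add t t (t + 3))
           (Seq (Const (t + 3) 1) (Seq (Add (t + 1) (t + 1) (t + 3)) (Sub (t + 2) (t + 2) (t + 3)))))))))"

text \<open>In the loops of both compilers register \<open>t + 1\<close> counts up and is the new
  variable, \<open>t + 2\<close> counts down and ends the loop, and the body works from
  \<open>t + 3\<close> on.\<close>

primrec ccomp :: "cmd \<Rightarrow> (nat \<Rightarrow> nat) \<Rightarrow> nat \<Rightarrow> ram" where
  "ccomp (Write a e) \<rho> t = Seq (comp a \<rho> t) (Seq (comp e \<rho> (t + 1)) (Store t (t + 1)))"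
| "ccomp (Then c d) \<rho> t = Seq (ccomp c \<rho> t) (ccomp d \<rho> t)"
| "ccomp (For y c) \<rho> t =
     Seq (Const (t + 1) 0) (Seq (Add (t + 2) (\<rho> y) (t + 1))
       (While (t + 2)
         (Seq (ccomp c (case_nat (t + 1) \<rho>) (t + 3))
           (Seq (Const (t + 3) 1) (Seq (Add (t + 1) (t + 1) (t + 3)) (Sub (t + 2) (t + 2) (t + 3)))))))"

text \<open>The polynomials are in a common bound for the variables.\<close>

primrec cost :: "expr \<Rightarrow> nat poly" where
  "cost (Var k) = 2"
| "cost (Num c) = [:Suc (bits c):]"
| "cost (Plus a b) = cost a + cost b + 1"
| "cost (Minus a b) = cost a + cost b + 1"
| "cost (Cell a) = cost a + 1"
| "cost (Cond a b c) = cost a + cost b + cost c + 1"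
| "cost (Sigma y e) = 4 + [:0, 1:] * (cost e + 6)"

primrec ccost :: "cmd \<Rightarrow> nat poly" where
  "ccost (Write a e) = cost a + cost e + 1"
| "ccost (Then c d) = ccost c + ccost d"
| "ccost (For y c) = 3 + [:0, 1:] * (ccost c + 5)"

section \<open>Correctness and cost of the compiler\<close>

text \<open>All variables live below \<open>t\<close>, where evaluation does not write. Their bound
  \<open>L\<close> is what limits the number of iterations of every loop.\<close>

definition rep :: "nat \<Rightarrow> (nat \<Rightarrow> nat) \<Rightarrow> nat \<Rightarrow> (nat \<Rightarrow> nat) \<Rightarrow> (nat \<Rightarrow> nat) \<Rightarrow> bool" where
  "rep L \<rho> t \<sigma> R \<longleftrightarrow> (\<forall>k. \<rho> k < t \<and> R (\<rho> k) = \<sigma> k \<and> \<sigma> k \<le> L)"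

lemma rep_agree: "rep L \<rho> t \<sigma> R \<Longrightarrow> (\<And>x. x < t \<Longrightarrow> R' x = R x) \<Longrightarrow> t \<le> t' \<Longrightarrow> rep L \<rho> t' \<sigma> R'"
  unfolding rep_def by (metis less_le_trans)

text \<open>The bound \<open>L\<close> survives the entry into a loop because the new variable stays
  below an older one.\<close>

lemma rep_bind:
  assumes "rep L \<rho> t \<sigma> R" "R' (t + 1) = i" "i < \<sigma> y" "\<And>x. x < t \<Longrightarrow> R' x = R x"
  shows "rep L (case_nat (t + 1) \<rho>) (t + 3) (case_nat i \<sigma>) R'"
proof -
  have "i \<le> L" using assms unfolding rep_def by (meson less_imp_le less_le_trans)
  then show ?thesis
    using assms unfolding rep_def
    by (auto split: nat.split simp: less_Suc_eq trans_less_add1)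
qed

text \<open>The same \<open>L\<close> serves at every depth, so each nested sum multiplies the cost
  by at most \<open>L\<close> and the bound is a polynomial fixed by the expression.\<close>

lemma comp_correct:
  assumes "rep L \<rho> t \<sigma> R"
  shows "\<exists>R'. runs (comp e \<rho> t) (R, M) (poly (cost e) L) (R', M) \<and>
    (\<forall>x<t. R' x = R x) \<and> R' t = val e \<sigma> M"
  using assms
proof (induction e arbitrary: \<rho> t \<sigma> R)
  case (Var k)
  \<comment> \<open>There is no move instruction: the variable is copied by adding the 0 just put
    into the free register \<open>t + 1\<close>.\<close>
  have "runs (comp (Var k) \<rho> t) (R, M) (Suc (bits 0) + 1)
      (R(t + 1 := 0, t := (R(t + 1 := 0)) (\<rho> k) + (R(t + 1 := 0)) (t + 1)), M)"
    unfolding comp.simps by (rule runs_Seq[OF runs_Const runs_Add])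
  moreover have "\<rho> k < t" "R (\<rho> k) = \<sigma> k" using Var unfolding rep_def by auto
  ultimately have "runs (comp (Var k) \<rho> t) (R, M) (poly (cost (Var k)) L)
      (R(t + 1 := 0, t := \<sigma> k), M)"
    by (simp add: floorlog_def numeral_2_eq_2)
  moreover have "\<forall>x<t. (R(t + 1 := 0, t := \<sigma> k)) x = R x"
    "(R(t + 1 := 0, t := \<sigma> k)) t = val (Var k) \<sigma> M"
    by auto
  ultimately show ?case by blast
next
  case (Num c)
  then show ?case using runs_Const[of t c R M] by (auto intro!: exI)
next
  case (Plus a b)
  obtain R1 where 1: "runs (comp a \<rho> t) (R, M) (poly (cost a) L) (R1, M)"
    "\<forall>x<t. R1 x = R x" "R1 t = val a \<sigma> M"
    using Plus.IH(1)[OF Plus.prems] by blast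
  have "rep L \<rho> (t + 1) \<sigma> R1" by (rule rep_agree[OF Plus.prems]) (use 1 in auto)
  then obtain R2 where 2: "runs (comp b \<rho> (t + 1)) (R1, M) (poly (cost b) L) (R2, M)"
    "\<forall>x<t + 1. R2 x = R1 x" "R2 (t + 1) = val b \<sigma> M"
    using Plus.IH(2) by blast
  have "runs (comp (Plus a b) \<rho> t) (R, M) (poly (cost a) L + (poly (cost b) L + 1))
      (R2(t := R2 t + R2 (t + 1)), M)"
    unfolding comp.simps by (intro runs_Seq[OF 1(1)] runs_Seq[OF 2(1)] runs_Add)
  then have "runs (comp (Plus a b) \<rho> t) (R, M) (poly (cost (Plus a b)) L)
      (R2(t := R2 t + R2 (t + 1)), M)"
    by simp
  moreover have "\<forall>x<t. (R2(t := R2 t + R2 (t + 1))) x = R x"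
    "(R2(t := R2 t + R2 (t + 1))) t = val (Plus a b) \<sigma> M"
    using 1 2 by auto
  ultimately show ?case by blast
next
  case (Minus a b)
  obtain R1 where 1: "runs (comp a \<rho> t) (R, M) (poly (cost a) L) (R1, M)"
    "\<forall>x<t. R1 x = R x" "R1 t = val a \<sigma> M"
    using Minus.IH(1)[OF Minus.prems] by blast
  have "rep L \<rho> (t + 1) \<sigma> R1" by (rule rep_agree[OF Minus.prems]) (use 1 in auto)
  then obtain R2 where 2: "runs (comp b \<rho> (t + 1)) (R1, M) (poly (cost b) L) (R2, M)"
    "\<forall>x<t + 1. R2 x = R1 x" "R2 (t + 1) = val b \<sigma> M"
    using Minus.IH(2) by blast
  have "runs (comp (Minus a b) \<rho> t) (R, M) (poly (cost a) L + (poly (cost b) L + 1))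
      (R2(t := R2 t - R2 (t + 1)), M)"
    unfolding comp.simps by (intro runs_Seq[OF 1(1)] runs_Seq[OF 2(1)] runs_Sub)
  then have "runs (comp (Minus a b) \<rho> t) (R, M) (poly (cost (Minus a b)) L)
      (R2(t := R2 t - R2 (t + 1)), M)"
    by simp
  moreover have "\<forall>x<t. (R2(t := R2 t - R2 (t + 1))) x = R x"
    "(R2(t := R2 t - R2 (t + 1))) t = val (Minus a b) \<sigma> M"
    using 1 2 by auto
  ultimately show ?case by blast
next
  case (Cell a)
  obtain R1 where 1: "runs (comp a \<rho> t) (R, M) (poly (cost a) L) (R1, M)"
    "\<forall>x<t. R1 x = R x" "R1 t = val a \<sigma> M"
    using Cell.IH[OF Cell.prems] by blast
  have "runs (comp (Cell a) \<rho> t) (R, M) (poly (cost a) L + 1) (R1(t := M (R1 t)), M)"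
    unfolding comp.simps by (intro runs_Seq[OF 1(1)] runs_Load)
  then have "runs (comp (Cell a) \<rho> t) (R, M) (poly (cost (Cell a)) L) (R1(t := M (R1 t)), M)"
    by simp
  moreover have "\<forall>x<t. (R1(t := M (R1 t))) x = R x"
    "(R1(t := M (R1 t))) t = val (Cell a) \<sigma> M"
    using 1 by auto
  ultimately show ?case by blast
next
  case (Cond a b c)
  obtain R1 where 1: "runs (comp a \<rho> t) (R, M) (poly (cost a) L) (R1, M)"
    "\<forall>x<t. R1 x = R x" "R1 t = val a \<sigma> M"
    using Cond.IH(1)[OF Cond.prems] by blast
  have rep1: "rep L \<rho> t \<sigma> R1" by (rule rep_agree[OF Cond.prems]) (use 1 in auto)
  obtain R2 where 2: "runs (comp b \<rho> t) (R1, M) (poly (cost b) L) (R2, M)"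
    "\<forall>x<t. R2 x = R1 x" "R2 t = val b \<sigma> M"
    using Cond.IH(2)[OF rep1] by blast
  obtain R3 where 3: "runs (comp c \<rho> t) (R1, M) (poly (cost c) L) (R3, M)"
    "\<forall>x<t. R3 x = R1 x" "R3 t = val c \<sigma> M"
    using Cond.IH(3)[OF rep1] by blast
  define R4 where "R4 = (if R1 t \<noteq> 0 then R2 else R3)"
  have "runs (ram.If t (comp b \<rho> t) (comp c \<rho> t)) (R1, M)
      (Suc (poly (cost b) L + poly (cost c) L)) (R4, M)"
    by (rule runs_If)
      (use 2 3 in \<open>auto simp: R4_def elim: runs_mono\<close>)
  then have "runs (comp (Cond a b c) \<rho> t) (R, M)
      (poly (cost a) L + Suc (poly (cost b) L + poly (cost c) L)) (R4, M)"
    unfolding comp.simps by (rule runs_Seq[OF 1(1)])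
  then show ?case using 1 2 3 by (intro exI[of _ R4]) (auto simp: R4_def add_ac)
next
  case (Sigma y e)
  define k where "k = poly (cost e) L"
  define Inv where "Inv i R' M' \<longleftrightarrow> M' = M \<and> (\<forall>x<t. R' x = R x) \<and>
      R' t = (\<Sum>i<i. val e (case_nat i \<sigma>) M) \<and> R' (t + 1) = i" for i R' M'
  define R0 where "R0 = R(t := 0, t + 1 := 0, t + 2 := \<sigma> y)"
  have y: "\<rho> y < t" "R (\<rho> y) = \<sigma> y" "\<sigma> y \<le> L" using Sigma.prems unfolding rep_def by auto
  let ?body = "Seq (comp e (case_nat (t + 1) \<rho>) (t + 3)) (Seq (Add t t (t + 3))
     (Seq (Const (t + 3) 1) (Seq (Add (t + 1) (t + 1) (t + 3)) (Sub (t + 2) (t + 2) (t + 3)))))"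
  have init: "runs (Const t 0) (R, M) (Suc (bits 0)) (R(t := 0), M)"
    "runs (Const (t + 1) 0) (R(t := 0), M) (Suc (bits 0)) (R(t := 0, t + 1 := 0), M)"
    "runs (Add (t + 2) (\<rho> y) (t + 1)) (R(t := 0, t + 1 := 0), M) 1 (R0, M)"
    using runs_Const[of t 0 R M] runs_Const[of "t + 1" 0 "R(t := 0)" M]
      runs_Add[of "t + 2" "\<rho> y" "t + 1" "R(t := 0, t + 1 := 0)" M] y
    by (auto simp: R0_def)
  have "\<exists>R' M'. runs (While (t + 2) ?body) (R0, M) (Suc (\<sigma> y * Suc (k + 5))) (R', M') \<and>
      Inv (\<sigma> y) R' M'"
  proof (rule runs_countdown)
    fix i R1 M1 assume i: "i < \<sigma> y" "R1 (t + 2) = \<sigma> y - i" "Inv i R1 M1"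
    have "rep L (case_nat (t + 1) \<rho>) (t + 3) (case_nat i \<sigma>) R1"
      by (rule rep_bind[OF Sigma.prems, of _ _ y]) (use i in \<open>auto simp: Inv_def\<close>)
    from Sigma.IH[OF this] obtain R2 where
      2: "runs (comp e (case_nat (t + 1) \<rho>) (t + 3)) (R1, M) k (R2, M)"
        "\<forall>x<t + 3. R2 x = R1 x" "R2 (t + 3) = val e (case_nat i \<sigma>) M"
      unfolding k_def by blast
    define R3 where "R3 = R2(t := R2 t + R2 (t + 3))"
    \<comment> \<open>The summand in register \<open>t + 3\<close> has been added, so the register
      is free to hold the 1 by which both counters change.\<close>
    define R4 where "R4 = R3(t + 3 := 1)"
    define R5 where "R5 = R4(t + 1 := R4 (t + 1) + R4 (t + 3))"
    define R6 where "R6 = R5(t + 2 := R5 (t + 2) - R5 (t + 3))"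
    have "runs (Const (t + 3) 1) (R3, M) 2 (R4, M)"
      using runs_Const[of "t + 3" 1 R3 M] by (simp add: R4_def floorlog_def numeral_2_eq_2)
    then have "runs ?body (R1, M) (k + (1 + (2 + (1 + 1)))) (R6, M)"
      unfolding R3_def R5_def R6_def
      by (intro runs_Seq[OF 2(1)] runs_Seq[OF runs_Add] runs_Seq[OF _ runs_Seq[OF runs_Add runs_Sub]])
    moreover have "M1 = M" using i by (simp add: Inv_def)
    moreover have "R6 (t + 2) = \<sigma> y - Suc i" "Inv (Suc i) R6 M"
      using i 2 by (auto simp: Inv_def R6_def R5_def R4_def R3_def)
    ultimately show "\<exists>R' M'. runs ?body (R1, M1) (k + 5) (R', M') \<and>
        R' (t + 2) = \<sigma> y - Suc i \<and> Inv (Suc i) R' M'"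
      by (auto simp: eval_nat_numeral)
  next
    show "R0 (t + 2) = \<sigma> y" "Inv 0 R0 M" by (auto simp: R0_def Inv_def)
  qed
  then obtain R' where R': "runs (While (t + 2) ?body) (R0, M) (Suc (\<sigma> y * Suc (k + 5))) (R', M)"
    "Inv (\<sigma> y) R' M" unfolding Inv_def by auto
  have "runs (comp (Sigma y e) \<rho> t) (R, M)
      (Suc (bits 0) + (Suc (bits 0) + (1 + Suc (\<sigma> y * Suc (k + 5))))) (R', M)"
    unfolding comp.simps
    by (rule runs_Seq[OF init(1) runs_Seq[OF init(2) runs_Seq[OF init(3) R'(1)]]])
  moreover have "Suc (bits 0) + (Suc (bits 0) + (1 + Suc (\<sigma> y * Suc (k + 5))))
      \<le> poly (cost (Sigma y e)) L"
    using mult_le_mono1[OF y(3), of "k + 6"] by (simp add: floorlog_def k_def add_ac)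
  ultimately have "runs (comp (Sigma y e) \<rho> t) (R, M) (poly (cost (Sigma y e)) L) (R', M)"
    by (rule runs_mono)
  then show ?case using R'(2) by (auto simp: Inv_def)
qed

text \<open>Unlike for expressions, the memory is generalized in the induction, since the second
  part of a sequence and every later iteration start from a changed one.\<close>

lemma ccomp_correct:
  assumes "rep L \<rho> t \<sigma> R"
  shows "\<exists>R'. runs (ccomp c \<rho> t) (R, M) (poly (ccost c) L) (R', effect c \<sigma> M) \<and> (\<forall>x<t. R' x = R x)"
  using assms
proof (induction c arbitrary: \<rho> t \<sigma> R M)
  case (Write a e)
  obtain R1 where 1: "runs (comp a \<rho> t) (R, M) (poly (cost a) L) (R1, M)"
    "\<forall>x<t. R1 x = R x" "R1 t = val a \<sigma> M"
    using comp_correct[OF Write.prems] by blast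
  have "rep L \<rho> (t + 1) \<sigma> R1" by (rule rep_agree[OF Write.prems]) (use 1 in auto)
  then obtain R2 where 2: "runs (comp e \<rho> (t + 1)) (R1, M) (poly (cost e) L) (R2, M)"
    "\<forall>x<t + 1. R2 x = R1 x" "R2 (t + 1) = val e \<sigma> M"
    using comp_correct by blast
  have "runs (ccomp (Write a e) \<rho> t) (R, M) (poly (cost a) L + (poly (cost e) L + 1))
      (R2, M(R2 t := R2 (t + 1)))"
    unfolding ccomp.simps by (intro runs_Seq[OF 1(1)] runs_Seq[OF 2(1)] runs_Store)
  moreover have "M(R2 t := R2 (t + 1)) = effect (Write a e) \<sigma> M"
    using 1 2 by simp
  ultimately show ?case using 1 2 by (intro exI[of _ R2]) (auto simp del: effect.simps)
next
  case (Then c d)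
  obtain R1 where 1: "runs (ccomp c \<rho> t) (R, M) (poly (ccost c) L) (R1, effect c \<sigma> M)"
    "\<forall>x<t. R1 x = R x"
    using Then.IH(1)[OF Then.prems] by blast
  have "rep L \<rho> t \<sigma> R1" by (rule rep_agree[OF Then.prems]) (use 1 in auto)
  then obtain R2 where 2: "runs (ccomp d \<rho> t) (R1, effect c \<sigma> M) (poly (ccost d) L)
      (R2, effect d \<sigma> (effect c \<sigma> M))" "\<forall>x<t. R2 x = R1 x"
    using Then.IH(2) by blast
  then show ?case using 1 by (intro exI[of _ R2]) (auto intro: runs_Seq)
next
  case (For y c)
  define k where "k = poly (ccost c) L"
  define Inv where "Inv i R' M' \<longleftrightarrow> M' = fold (\<lambda>i. effect c (case_nat i \<sigma>)) [0..<i] M \<and>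
      (\<forall>x<t. R' x = R x) \<and> R' (t + 1) = i" for i R' M'
  define R0 where "R0 = R(t + 1 := 0, t + 2 := \<sigma> y)"
  have y: "\<rho> y < t" "R (\<rho> y) = \<sigma> y" "\<sigma> y \<le> L" using For.prems unfolding rep_def by auto
  let ?body = "Seq (ccomp c (case_nat (t + 1) \<rho>) (t + 3))
     (Seq (Const (t + 3) 1) (Seq (Add (t + 1) (t + 1) (t + 3)) (Sub (t + 2) (t + 2) (t + 3))))"
  have init: "runs (Const (t + 1) 0) (R, M) (Suc (bits 0)) (R(t + 1 := 0), M)"
    "runs (Add (t + 2) (\<rho> y) (t + 1)) (R(t + 1 := 0), M) 1 (R0, M)"
    using runs_Const[of "t + 1" 0 R M]
      runs_Add[of "t + 2" "\<rho> y" "t + 1" "R(t + 1 := 0)" M] y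
    by (auto simp: R0_def)
  have "\<exists>R' M'. runs (While (t + 2) ?body) (R0, M) (Suc (\<sigma> y * Suc (k + 4))) (R', M') \<and>
      Inv (\<sigma> y) R' M'"
  proof (rule runs_countdown)
    fix i R1 M1 assume i: "i < \<sigma> y" "R1 (t + 2) = \<sigma> y - i" "Inv i R1 M1"
    have "rep L (case_nat (t + 1) \<rho>) (t + 3) (case_nat i \<sigma>) R1"
      by (rule rep_bind[OF For.prems, of _ _ y]) (use i in \<open>auto simp: Inv_def\<close>)
    from For.IH[OF this] obtain R2 where
      2: "runs (ccomp c (case_nat (t + 1) \<rho>) (t + 3)) (R1, M1) k (R2, effect c (case_nat i \<sigma>) M1)"
        "\<forall>x<t + 3. R2 x = R1 x"
      unfolding k_def by blast
    define R4 where "R4 = R2(t + 3 := 1)"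
    define R5 where "R5 = R4(t + 1 := R4 (t + 1) + R4 (t + 3))"
    define R6 where "R6 = R5(t + 2 := R5 (t + 2) - R5 (t + 3))"
    let ?M = "effect c (case_nat i \<sigma>) M1"
    have "runs (Const (t + 3) 1) (R2, ?M) 2 (R4, ?M)"
      using runs_Const[of "t + 3" 1 R2 ?M] by (simp add: R4_def floorlog_def numeral_2_eq_2)
    then have "runs ?body (R1, M1) (k + (2 + (1 + 1))) (R6, ?M)"
      unfolding R5_def R6_def
      by (intro runs_Seq[OF 2(1)] runs_Seq[OF _ runs_Seq[OF runs_Add runs_Sub]])
    moreover have "R6 (t + 2) = \<sigma> y - Suc i" "Inv (Suc i) R6 ?M"
      using i 2 by (auto simp: Inv_def R6_def R5_def R4_def)
    ultimately show "\<exists>R' M'. runs ?body (R1, M1) (k + 4) (R', M') \<and>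
        R' (t + 2) = \<sigma> y - Suc i \<and> Inv (Suc i) R' M'"
      by (auto simp: eval_nat_numeral)
  next
    show "R0 (t + 2) = \<sigma> y" "Inv 0 R0 M" by (auto simp: R0_def Inv_def)
  qed
  then obtain R' where R': "runs (While (t + 2) ?body) (R0, M) (Suc (\<sigma> y * Suc (k + 4)))
      (R', effect (For y c) \<sigma> M)" "\<forall>x<t. R' x = R x" unfolding Inv_def by auto
  have "runs (ccomp (For y c) \<rho> t) (R, M)
      (Suc (bits 0) + (1 + Suc (\<sigma> y * Suc (k + 4)))) (R', effect (For y c) \<sigma> M)"
    unfolding ccomp.simps by (rule runs_Seq[OF init(1) runs_Seq[OF init(2) R'(1)]])
  moreover have "Suc (bits 0) + (1 + Suc (\<sigma> y * Suc (k + 4))) \<le> poly (ccost (For y c)) L"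
    using mult_le_mono1[OF y(3), of "k + 5"] by (simp add: floorlog_def k_def add_ac)
  ultimately have "runs (ccomp (For y c) \<rho> t) (R, M) (poly (ccost (For y c)) L)
      (R', effect (For y c) \<sigma> M)"
    by (rule runs_mono)
  then show ?case using R'(2) by blast
qed

section \<open>Synthesis of programs from functions\<close>

text \<open>The predicates speak of functions instead of syntax. The algorithm can thus be written
  as ordinary functions, and the rules \<open>computable\<close> assemble the expression behind
  them.\<close>

definition computable_exp :: "((nat \<Rightarrow> nat) \<Rightarrow> (nat \<Rightarrow> nat) \<Rightarrow> nat) \<Rightarrow> bool" where
  "computable_exp f \<longleftrightarrow> (\<exists>e. \<forall>\<sigma> M. val e \<sigma> M = f \<sigma> M)"

definition computable_cond :: "((nat \<Rightarrow> nat) \<Rightarrow> (nat \<Rightarrow> nat) \<Rightarrow> bool) \<Rightarrow> bool" where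
  "computable_cond P \<longleftrightarrow> (\<exists>e. \<forall>\<sigma> M. (val e \<sigma> M \<noteq> 0) = P \<sigma> M)"

definition computable_cmd :: "((nat \<Rightarrow> nat) \<Rightarrow> (nat \<Rightarrow> nat) \<Rightarrow> nat \<Rightarrow> nat) \<Rightarrow> bool" where
  "computable_cmd F \<longleftrightarrow> (\<exists>c. \<forall>\<sigma> M. effect c \<sigma> M = F \<sigma> M)"

named_theorems computable

lemma computable_var [computable]: "computable_exp (\<lambda>\<sigma> M. \<sigma> k)"
  unfolding computable_exp_def by (rule exI[of _ "Var k"]) simp

lemma computable_const [computable]: "computable_exp (\<lambda>\<sigma> M. k)"
  unfolding computable_exp_def by (rule exI[of _ "Num k"]) simp

lemma computable_plus [computable]:
  assumes "computable_exp f" "computable_exp g"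
  shows "computable_exp (\<lambda>\<sigma> M. f \<sigma> M + g \<sigma> M)"
proof -
  obtain a b where "\<And>\<sigma> M. val a \<sigma> M = f \<sigma> M" "\<And>\<sigma> M. val b \<sigma> M = g \<sigma> M"
    using assms unfolding computable_exp_def by blast
  then show ?thesis unfolding computable_exp_def by (intro exI[of _ "Plus a b"]) simp
qed

lemma computable_minus [computable]:
  assumes "computable_exp f" "computable_exp g"
  shows "computable_exp (\<lambda>\<sigma> M. f \<sigma> M - g \<sigma> M)"
proof -
  obtain a b where "\<And>\<sigma> M. val a \<sigma> M = f \<sigma> M" "\<And>\<sigma> M. val b \<sigma> M = g \<sigma> M"
    using assms unfolding computable_exp_def by blast
  then show ?thesis unfolding computable_exp_def by (intro exI[of _ "Minus a b"]) simp
qed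

lemma computable_cell [computable]:
  assumes "computable_exp f"
  shows "computable_exp (\<lambda>\<sigma> M. M (f \<sigma> M))"
proof -
  obtain a where "\<And>\<sigma> M. val a \<sigma> M = f \<sigma> M"
    using assms unfolding computable_exp_def by blast
  then show ?thesis unfolding computable_exp_def by (intro exI[of _ "Cell a"]) simp
qed

lemma computable_if [computable]:
  assumes "computable_cond P" "computable_exp f" "computable_exp g"
  shows "computable_exp (\<lambda>\<sigma> M. if P \<sigma> M then f \<sigma> M else g \<sigma> M)"
proof -
  obtain a b c where "\<And>\<sigma> M. (val a \<sigma> M \<noteq> 0) = P \<sigma> M" "\<And>\<sigma> M. val b \<sigma> M = f \<sigma> M"
    "\<And>\<sigma> M. val c \<sigma> M = g \<sigma> M"
    using assms unfolding computable_exp_def computable_cond_def by metis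
  then show ?thesis unfolding computable_exp_def by (intro exI[of _ "Cond a b c"]) simp
qed

text \<open>Inside the sum the index is variable 0 and all others are shifted by one. Making
  \<open>f\<close> a function of the environment lets the rule perform this shift by
  unification.\<close>

lemma computable_sum [computable]:
  assumes "computable_exp (\<lambda>\<sigma> M. f (\<lambda>k. \<sigma> (Suc k)) M (\<sigma> 0))"
  shows "computable_exp (\<lambda>\<sigma> M. \<Sum>i<\<sigma> y. f \<sigma> M i)"
proof -
  obtain a where "\<And>\<sigma> M. val a \<sigma> M = f (\<lambda>k. \<sigma> (Suc k)) M (\<sigma> 0)"
    using assms unfolding computable_exp_def by blast
  then show ?thesis unfolding computable_exp_def by (intro exI[of _ "Sigma y a"]) simp
qed

text \<open>One factor is the bound of a loop and must therefore be a variable. The addresses in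
  \<open>pref_cell\<close> and \<open>row_cell\<close> are arranged to have such a factor on the
  left of every product.\<close>

lemma computable_times [computable]:
  assumes "computable_exp (\<lambda>\<sigma> M. f (\<lambda>k. \<sigma> (Suc k)) M)"
  shows "computable_exp (\<lambda>\<sigma> M. \<sigma> y * f \<sigma> M)"
  using computable_sum[of "\<lambda>\<sigma> M _. f \<sigma> M" y] assms by simp

lemma computable_min [computable]:
  assumes "computable_exp f" "computable_exp g"
  shows "computable_exp (\<lambda>\<sigma> M. min (f \<sigma> M) (g \<sigma> M))"
proof -
  have "(\<lambda>\<sigma> M. min (f \<sigma> M) (g \<sigma> M)) = (\<lambda>\<sigma> M. f \<sigma> M - (f \<sigma> M - g \<sigma> M))"
    by (intro ext) (auto simp: min_def)
  then show ?thesis using assms by (auto intro: computable_minus)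
qed

lemma computable_less [computable]:
  assumes "computable_exp f" "computable_exp g"
  shows "computable_cond (\<lambda>\<sigma> M. f \<sigma> M < g \<sigma> M)"
proof -
  obtain e where "\<And>\<sigma> M. val e \<sigma> M = g \<sigma> M - f \<sigma> M"
    using computable_minus[OF assms(2,1)] unfolding computable_exp_def by blast
  then show ?thesis unfolding computable_cond_def by (intro exI[of _ e]) (simp add: not_le)
qed

lemma computable_of_bool:
  assumes "computable_exp (\<lambda>\<sigma> M. if P \<sigma> M then 1 else 0)"
  shows "computable_cond P"
proof -
  obtain e where e: "\<And>\<sigma> M. val e \<sigma> M = (if P \<sigma> M then 1 else 0)"
    using assms unfolding computable_exp_def by blast
  show ?thesis unfolding computable_cond_def by (intro exI[of _ e]) (simp add: e)
qed

lemma computable_not [computable]: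
  assumes "computable_cond P"
  shows "computable_cond (\<lambda>\<sigma> M. \<not> P \<sigma> M)"
proof -
  obtain e where "\<And>\<sigma> M. (val e \<sigma> M \<noteq> 0) = P \<sigma> M"
    using assms unfolding computable_cond_def by blast
  then show ?thesis
    unfolding computable_cond_def by (intro exI[of _ "Minus (Num 1) e"]) (simp add: Suc_le_eq not_less)
qed

lemma computable_conj [computable]:
  assumes "computable_cond P" "computable_cond Q"
  shows "computable_cond (\<lambda>\<sigma> M. P \<sigma> M \<and> Q \<sigma> M)"
proof -
  have "computable_exp (\<lambda>\<sigma> M. if P \<sigma> M then if Q \<sigma> M then 1 else 0 else 0)"
    by (intro computable assms)
  then show ?thesis by (intro computable_of_bool) (simp add: if_if_eq_conj cong: if_cong)
qed

lemma computable_imp [computable]: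
  assumes "computable_cond P" "computable_cond Q"
  shows "computable_cond (\<lambda>\<sigma> M. P \<sigma> M \<longrightarrow> Q \<sigma> M)"
  using computable_not[OF computable_conj[OF assms(1) computable_not[OF assms(2)]]] by simp

lemma computable_le [computable]:
  assumes "computable_exp f" "computable_exp g"
  shows "computable_cond (\<lambda>\<sigma> M. f \<sigma> M \<le> g \<sigma> M)"
  using computable_not[OF computable_less[OF assms(2,1)]] by (simp add: not_less)

lemma computable_eq [computable]:
  assumes "computable_exp f" "computable_exp g"
  shows "computable_cond (\<lambda>\<sigma> M. f \<sigma> M = g \<sigma> M)"
proof -
  have "computable_cond (\<lambda>\<sigma> M. f \<sigma> M \<le> g \<sigma> M \<and> g \<sigma> M \<le> f \<sigma> M)"
    by (intro computable assms)
  then show ?thesis by (simp add: order_eq_iff)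
qed

lemma computable_bex [computable]:
  assumes "computable_cond (\<lambda>\<sigma> M. P (\<lambda>k. \<sigma> (Suc k)) M (\<sigma> 0))"
  shows "computable_cond (\<lambda>\<sigma> M. \<exists>i<\<sigma> y. P \<sigma> M i)"
proof -
  have "computable_cond (\<lambda>\<sigma> M. 0 < (\<Sum>i<\<sigma> y. if P \<sigma> M i then 1 else 0 :: nat))"
    by (intro computable assms)
  moreover have "0 < (\<Sum>i<\<sigma> y. if P \<sigma> M i then 1 else 0 :: nat) \<longleftrightarrow> (\<exists>i<\<sigma> y. P \<sigma> M i)" for \<sigma> M
    unfolding zero_less_iff_neq_zero sum_eq_0_iff[OF finite_lessThan] by auto
  ultimately show ?thesis by (simp only:)
qed

lemma computable_ball [computable]:
  assumes "computable_cond (\<lambda>\<sigma> M. P (\<lambda>k. \<sigma> (Suc k)) M (\<sigma> 0))"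
  shows "computable_cond (\<lambda>\<sigma> M. \<forall>i<\<sigma> y. P \<sigma> M i)"
  using computable_not[OF computable_bex[where P = "\<lambda>\<sigma> M i. \<not> P \<sigma> M i", OF computable_not[OF assms]]]
  by simp

lemma computable_write [computable]:
  assumes "computable_exp f" "computable_exp g"
  shows "computable_cmd (\<lambda>\<sigma> M. M(f \<sigma> M := g \<sigma> M))"
proof -
  obtain a b where "\<And>\<sigma> M. val a \<sigma> M = f \<sigma> M" "\<And>\<sigma> M. val b \<sigma> M = g \<sigma> M"
    using assms unfolding computable_exp_def by blast
  then show ?thesis unfolding computable_cmd_def by (intro exI[of _ "Write a b"]) simp
qed

text \<open>Not declared \<open>computable\<close>, because a goal can be split into
  \<open>F\<close> and \<open>G\<close> in many ways; its uses supply both functions.\<close>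

lemma computable_then:
  assumes "computable_cmd F" "computable_cmd G"
  shows "computable_cmd (\<lambda>\<sigma> M. G \<sigma> (F \<sigma> M))"
proof -
  obtain c d where "\<And>\<sigma> M. effect c \<sigma> M = F \<sigma> M" "\<And>\<sigma> M. effect d \<sigma> M = G \<sigma> M"
    using assms unfolding computable_cmd_def by metis
  then show ?thesis unfolding computable_cmd_def by (intro exI[of _ "Then c d"]) simp
qed

lemma computable_for [computable]:
  assumes "computable_cmd (\<lambda>\<sigma> M. F (\<lambda>k. \<sigma> (Suc k)) (\<sigma> 0) M)"
  shows "computable_cmd (\<lambda>\<sigma> M. fold (F \<sigma>) [0..<\<sigma> y] M)"
proof -
  obtain c where "\<And>\<sigma> M. effect c \<sigma> M = F (\<lambda>k. \<sigma> (Suc k)) (\<sigma> 0) M"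
    using assms unfolding computable_cmd_def by blast
  then have "effect c (case_nat i \<sigma>) = F \<sigma> i" for i \<sigma> by (simp add: fun_eq_iff)
  then show ?thesis unfolding computable_cmd_def by (intro exI[of _ "For y c"]) simp
qed

text \<open>The first three words become the variables and hence the loop bounds. A word in binary
  may be exponential in the input size, so these three are required not to exceed the input
  length.\<close>

lemma polytime_computableI:
  assumes F: "computable_cmd F"
    and "\<And>xs ys. (xs, ys) \<in> I \<Longrightarrow>
      length xs \<ge> 3 \<and> xs ! 0 \<le> length xs \<and> xs ! 1 \<le> length xs \<and> xs ! 2 \<le> length xs \<and>
      ys = map (F (\<lambda>k. if k = 0 then xs ! 0 else if k = 1 then xs ! 1 else xs ! 2)
        (snd (input_state xs))) [0..<xs ! 2]"
  shows "polytime_computable I"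
proof -
  obtain c where c: "\<And>\<sigma> M. effect c \<sigma> M = F \<sigma> M"
    using F unfolding computable_cmd_def by blast
  \<comment> \<open>Variable 2 is the number of output words. It is kept in register 0, where the
    length of the output is expected; the compiled command leaves the registers below 3
    alone.\<close>
  define \<rho> :: "nat \<Rightarrow> nat" where "\<rho> k = (if k = 0 then 1 else if k = 1 then 2 else 0)" for k
  define p where "p = Seq (Const 0 0) (Seq (Load 1 0) (Seq (Const 0 1) (Seq (Load 2 0)
    (Seq (Const 0 2) (Seq (Load 0 0) (ccomp c \<rho> 3))))))"
  \<comment> \<open>Loading the three variables costs at most 9, namely 1 + 2 + 3 for the constants
    and 1 for each load, which 11 covers.\<close>
  define k where "k = 11 + ccost c"
  define q where "q = k * (2 * ([:0, 1:] + k) + 1)"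
  have "\<exists>t s. exec p (input_state xs) t s \<and> output_of s = ys \<and> t \<le> poly q (input_size xs)"
    if "(xs, ys) \<in> I" for xs ys
  proof -
    let ?N = "input_size xs"
    define M where "M = snd (input_state xs)"
    define R where "R = fst (input_state xs)"
    define \<sigma> where "\<sigma> k = (if k = 0 then xs ! 0 else if k = 1 then xs ! 1 else xs ! 2)" for k :: nat
    have xs: "length xs \<ge> 3" "xs ! 0 \<le> length xs" "xs ! 1 \<le> length xs" "xs ! 2 \<le> length xs"
      and ys: "ys = map (F \<sigma> M) [0..<xs ! 2]"
      using assms(2)[OF that] by (auto simp: \<sigma>_def[abs_def] M_def)
    have len: "length xs \<le> ?N"
      unfolding input_size_def by (induction xs) auto
    have bits_le: "bits x \<le> ?N" if "x \<in> set xs" for x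
      using that unfolding input_size_def by (induction xs) auto
    have M: "M 0 = xs ! 0" "M 1 = xs ! 1" "M 2 = xs ! 2"
      using xs(1) by (auto simp: M_def input_state_def)
    define R' where "R' = R(0 := xs ! 2, 1 := xs ! 0, 2 := xs ! 1)"
    have eqs: "R(0 := 0, 1 := M ((R(0 := 0)) 0)) = R(0 := 0, 1 := xs ! 0)"
      "R(0 := 0, 1 := xs ! 0, 0 := 1, 2 := M ((R(0 := 0, 1 := xs ! 0, 0 := 1)) 0))
        = R(0 := 1, 1 := xs ! 0, 2 := xs ! 1)"
      "R(0 := 1, 1 := xs ! 0, 2 := xs ! 1, 0 := 2,
          0 := M ((R(0 := 1, 1 := xs ! 0, 2 := xs ! 1, 0 := 2)) 0)) = R'"
      using M by (auto simp: R'_def fun_eq_iff)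
    have "rep ?N \<rho> 3 \<sigma> R'"
      using xs len by (auto simp: rep_def \<rho>_def \<sigma>_def R'_def)
    then obtain R'' where R'': "runs (ccomp c \<rho> 3) (R', M) (poly (ccost c) ?N) (R'', F \<sigma> M)"
      "\<forall>x<3. R'' x = R' x"
      using ccomp_correct[of ?N \<rho> 3 \<sigma> R' c M] c by auto
    have "runs p (R, M) (Suc (bits 0) + (1 + (Suc (bits 1) + (1 + (Suc (bits 2) +
        (1 + poly (ccost c) ?N)))))) (R'', F \<sigma> M)"
      unfolding p_def
      by (rule runs_Seq[OF runs_Const runs_Seq[OF runs_Load[of 1 0 "R(0 := 0)" M, unfolded eqs(1)]
        runs_Seq[OF runs_Const runs_Seq[OF runs_Load[of 2 0 "R(0 := 0, 1 := xs ! 0, 0 := 1)" M, unfolded eqs(2)]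
        runs_Seq[OF runs_Const runs_Seq[OF runs_Load[of 0 0 "R(0 := 1, 1 := xs ! 0, 2 := xs ! 1, 0 := 2)" M, unfolded eqs(3)]
        R''(1)]]]]]])
    moreover have "Suc (bits 0) + (1 + (Suc (bits 1) + (1 + (Suc (bits 2) +
        (1 + poly (ccost c) ?N))))) \<le> poly k ?N"
    proof -
      have "bits 0 \<le> 0" "bits 1 \<le> 1" "bits 2 \<le> 2" by (simp_all only: bits_le_iff) auto
      then show ?thesis by (simp add: k_def)
    qed
    ultimately have "runs p (R, M) (poly k ?N) (R'', F \<sigma> M)"
      by (rule runs_mono)
    then obtain t where t: "exec p (R, M) t (R'', F \<sigma> M)"
      "\<And>K. fits K (R, M) \<Longrightarrow> t \<le> poly k ?N * (2 * (K + poly k ?N) + 1)"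
      unfolding runs_def by metis
    have "length xs < 2 ^ ?N"
      using len less_exp[of ?N] by linarith
    then have "fits ?N (R, M)"
      using bits_le by (auto simp: fits_def R_def M_def input_state_def bits_le_iff)
    then have "t \<le> poly k ?N * (2 * (?N + poly k ?N) + 1)"
      by (rule t(2))
    also have "\<dots> = poly q ?N"
      by (simp add: q_def)
    finally have "t \<le> poly q ?N" .
    moreover have "output_of (R'', F \<sigma> M) = ys"
      using R''(2) ys by (simp add: output_of_def R'_def)
    moreover have "input_state xs = (R, M)" by (simp add: R_def M_def)
    ultimately show ?thesis using t(1) by auto
  qed
  then show ?thesis unfolding polytime_computable_def by blast
qed

section \<open>The outcome of the MES rule\<close>

text \<open>
  These are the members of \<open>S\<close> whose whole budget is below \<open>\<rho>\<close>: the sum increases with \<open>b s\<close>, and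
  it is 1 if \<open>b s\<close> is replaced by \<open>\<rho>\<close>.
\<close>

definition poor :: "'i set \<Rightarrow> ('i \<Rightarrow> real) \<Rightarrow> 'i set" where
  "poor S b = {s \<in> S. (\<Sum>s'\<in>S. min (b s) (b s')) < 1}"

definition min_rho :: "'i set \<Rightarrow> ('i \<Rightarrow> real) \<Rightarrow> real" where
  "min_rho S b = (1 - sum b (poor S b)) / real (card (S - poor S b))"

text \<open>A richest voter is not poor: no budget exceeds its own, so the minima add up to the
  total budget.\<close>

lemma rich_nonempty:
  fixes b :: "'i \<Rightarrow> real"
  assumes "finite S" "\<And>s. s \<in> S \<Longrightarrow> b s \<ge> 0" "sum b S \<ge> 1"
  shows "S - poor S b \<noteq> {}"
proof -
  have "S \<noteq> {}" using assms(3) by auto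
  then obtain s where s: "s \<in> S" "\<And>s'. s' \<in> S \<Longrightarrow> b s' \<le> b s"
    using ex_is_arg_min_if_finite[OF assms(1), of "\<lambda>s. - b s"] by (auto simp: is_arg_min_linorder)
  then have "(\<Sum>s'\<in>S. min (b s) (b s')) = sum b S"
    by (intro sum.cong) (auto simp: min_def intro: antisym)
  then show ?thesis using s assms(3) by (auto simp: poor_def)
qed

text \<open>Poverty passes to smaller budgets, so a price can separate the poor from the
  rest.\<close>

lemma poor_mono:
  fixes b :: "'i \<Rightarrow> real"
  assumes "s \<in> poor S b" "s' \<in> S" "b s' \<le> b s"
  shows "s' \<in> poor S b"
proof -
  have "(\<Sum>t\<in>S. min (b s') (b t)) \<le> (\<Sum>t\<in>S. min (b s) (b t))"
    using assms(3) by (intro sum_mono) (auto simp: min_def)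
  then show ?thesis using assms by (auto simp: poor_def)
qed

text \<open>As long as the price \<open>x\<close> separates the two groups, what is collected is
  linear in \<open>x\<close>; \<open>min_rho\<close> is the point where this linear function is
  1.\<close>

lemma sum_min_split:
  fixes b :: "'i \<Rightarrow> real"
  assumes "finite S" "\<And>s. s \<in> poor S b \<Longrightarrow> b s \<le> x" "\<And>s. s \<in> S - poor S b \<Longrightarrow> x \<le> b s"
  shows "(\<Sum>s\<in>S. min x (b s)) = sum b (poor S b) + real (card (S - poor S b)) * x"
proof -
  have "poor S b \<subseteq> S" by (auto simp: poor_def)
  then have "(\<Sum>s\<in>S. min x (b s)) =
      (\<Sum>s\<in>poor S b. min x (b s)) + (\<Sum>s\<in>S - poor S b. min x (b s))"
    using assms(1) by (subst add.commute) (rule sum.subset_diff)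
  also have "(\<Sum>s\<in>poor S b. min x (b s)) = sum b (poor S b)"
    using assms(2) by (intro sum.cong) (auto simp: min_def intro: antisym)
  also have "(\<Sum>s\<in>S - poor S b. min x (b s)) = (\<Sum>s\<in>S - poor S b. x)"
    using assms(3) by (intro sum.cong) (auto simp: min_def)
  finally show ?thesis by simp
qed

text \<open>The linear formula is evaluated at the largest poor budget and at the smallest other
  one. By the definition of \<open>poor\<close> its value is below 1 at the former and at least 1 at
  the latter, so the solution lies between them.\<close>

lemma poor_less_min_rho_le_rich:
  fixes b :: "'i \<Rightarrow> real"
  assumes "finite S" "\<And>s. s \<in> S \<Longrightarrow> b s \<ge> 0" "sum b S \<ge> 1"
  shows "s \<in> poor S b \<Longrightarrow> b s < min_rho S b" "s \<in> S - poor S b \<Longrightarrow> min_rho S b \<le> b s"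
proof -
  let ?P = "poor S b" and ?Q = "S - poor S b"
  have fin: "finite ?P" "finite ?Q" using assms(1) by (auto simp: poor_def)
  have k: "real (card ?Q) > 0"
    using rich_nonempty[OF assms] fin by (simp add: card_gt_0_iff)
  {
    assume s: "s \<in> ?P"
    then obtain t where t: "t \<in> ?P" "\<And>s'. s' \<in> ?P \<Longrightarrow> b s' \<le> b t"
      using ex_is_arg_min_if_finite[OF fin(1), of "\<lambda>s. - b s"] by (auto simp: is_arg_min_linorder)
    have "b t \<le> b s'" if "s' \<in> ?Q" for s'
      using poor_mono[OF t(1), of s'] that by fastforce
    then have "(\<Sum>s'\<in>S. min (b t) (b s')) = sum b ?P + real (card ?Q) * b t"
      using t(2) by (intro sum_min_split[OF assms(1)]) auto
    then have "real (card ?Q) * b t < 1 - sum b ?P"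
      using t(1) by (auto simp: poor_def)
    then have "b t < min_rho S b" using k by (simp add: min_rho_def field_simps)
    then show "b s < min_rho S b" using t(2)[OF s] by linarith
  next
    assume s: "s \<in> ?Q"
    then obtain t where t: "t \<in> ?Q" "\<And>s'. s' \<in> ?Q \<Longrightarrow> b t \<le> b s'"
      using ex_is_arg_min_if_finite[OF fin(2), of b] by (auto simp: is_arg_min_linorder)
    have "b s' \<le> b t" if "s' \<in> ?P" for s'
      using poor_mono[OF that, of t] t(1) by fastforce
    then have "(\<Sum>s'\<in>S. min (b t) (b s')) = sum b ?P + real (card ?Q) * b t"
      using t(2) by (intro sum_min_split[OF assms(1)]) auto
    then have "1 - sum b ?P \<le> real (card ?Q) * b t"
      using t(1) by (auto simp: poor_def)
    then have "min_rho S b \<le> b t" using k by (simp add: min_rho_def field_simps)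
    then show "min_rho S b \<le> b s" using t(2)[OF s] by linarith
  }
qed

lemma sum_min_min_rho:
  fixes b :: "'i \<Rightarrow> real"
  assumes "finite S" "\<And>s. s \<in> S \<Longrightarrow> b s \<ge> 0" "sum b S \<ge> 1"
  shows "(\<Sum>s\<in>S. min (min_rho S b) (b s)) = 1"
proof -
  have "card (S - poor S b) \<noteq> 0"
    using rich_nonempty[OF assms] assms(1) by auto
  moreover have "(\<Sum>s\<in>S. min (min_rho S b) (b s)) =
      sum b (poor S b) + real (card (S - poor S b)) * min_rho S b"
    using poor_less_min_rho_le_rich[OF assms] by (intro sum_min_split assms) (auto intro: less_imp_le)
  ultimately show ?thesis by (simp add: min_rho_def)
qed

text \<open>At a price below \<open>min_rho\<close> nobody pays more, and a supporter who is not
  poor pays strictly less, so the sum is below 1.\<close>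

lemma min_rho_le:
  fixes b :: "'i \<Rightarrow> real"
  assumes "finite S" "\<And>s. s \<in> S \<Longrightarrow> b s \<ge> 0" "sum b S \<ge> 1" "(\<Sum>s\<in>S. min x (b s)) = 1"
  shows "min_rho S b \<le> x"
proof (rule ccontr)
  assume "\<not> min_rho S b \<le> x"
  then have x: "x < min_rho S b" by simp
  obtain s where s: "s \<in> S - poor S b" using rich_nonempty[OF assms(1-3)] by auto
  have "(\<Sum>s\<in>S. min x (b s)) < (\<Sum>s\<in>S. min (min_rho S b) (b s))"
  proof (rule sum_strict_mono_ex1[OF assms(1)])
    show "\<exists>s\<in>S. min x (b s) < min (min_rho S b) (b s)"
      using s x poor_less_min_rho_le_rich(2)[OF assms(1-3), OF _ s]
      by (intro bexI[of _ s]) (auto simp: min_def)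
  qed (use x in \<open>auto simp: min_def\<close>)
  then show False using assms(4) sum_min_min_rho[OF assms(1-3)] by simp
qed

lemma min_rho_pos:
  fixes b :: "'i \<Rightarrow> real"
  assumes "finite S" "\<And>s. s \<in> S \<Longrightarrow> b s \<ge> 0" "sum b S \<ge> 1"
  shows "min_rho S b > 0"
proof (rule ccontr)
  assume "\<not> min_rho S b > 0"
  then have "(\<Sum>s\<in>S. min (min_rho S b) (b s)) \<le> 0"
    by (intro sum_nonpos) (auto simp: min_def)
  then show False using sum_min_min_rho[OF assms] by simp
qed

section \<open>Existence and uniqueness of a round\<close>

abbreviation candidate_rho :: "'c election \<Rightarrow> nat \<Rightarrow> (nat \<Rightarrow> real) \<Rightarrow> nat \<Rightarrow> 'c \<Rightarrow> real" where
  "candidate_rho E j b r c \<equiv> min_rho (supporters E j c r) b"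

lemma finite_supporters [simp]: "finite (supporters E j c r)"
  by (simp add: supporters_def voters_def)

lemma supporters_subset: "supporters E j c r \<subseteq> voters E"
  by (auto simp: supporters_def)

lemmas supportersD = subsetD[OF supporters_subset]

lemma supporters_mono: "r \<le> r' \<Longrightarrow> supporters E j c r \<subseteq> supporters E j c r'"
  by (auto simp: supporters_def top_set_def dest: subsetD[OF set_take_subset_set_take])

definition nonneg_budgets :: "'c election \<Rightarrow> (nat \<Rightarrow> real) \<Rightarrow> bool" where
  "nonneg_budgets E b \<longleftrightarrow> (\<forall>i\<in>voters E. b i \<ge> 0)"

lemma purchasable_budgets:
  assumes "nonneg_budgets E b" "c \<in> purchasable E j b r"
  shows "finite (supporters E j c r)" "\<And>s. s \<in> supporters E j c r \<Longrightarrow> b s \<ge> 0"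
    "sum b (supporters E j c r) \<ge> 1"
  using assms by (auto simp: nonneg_budgets_def purchasable_def dest: supportersD)

lemma sum_min_candidate_rho:
  assumes "nonneg_budgets E b" "c \<in> purchasable E j b r"
  shows "(\<Sum>i\<in>supporters E j c r. min (candidate_rho E j b r c) (b i)) = 1"
  using purchasable_budgets[OF assms] by (rule sum_min_min_rho)

lemma candidate_rho_pos:
  assumes "nonneg_budgets E b" "c \<in> purchasable E j b r"
  shows "candidate_rho E j b r c > 0"
  using purchasable_budgets[OF assms] by (rule min_rho_pos)

lemma affordable_candidate_rho:
  assumes "nonneg_budgets E b" "c \<in> purchasable E j b r"
  shows "affordable E j b r (candidate_rho E j b r c) c"
  using assms by (auto simp: affordable_def sum_min_candidate_rho candidate_rho_pos)

lemma candidate_rho_le: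
  assumes "nonneg_budgets E b" "c \<in> purchasable E j b r" "affordable E j b r \<rho> c"
  shows "candidate_rho E j b r c \<le> \<rho>"
  using purchasable_budgets[OF assms(1,2)] assms(3) by (auto simp: affordable_def intro: min_rho_le)

definition least_cutoff :: "'c election \<Rightarrow> nat \<Rightarrow> (nat \<Rightarrow> real) \<Rightarrow> nat \<Rightarrow> bool" where
  "least_cutoff E j b r \<longleftrightarrow> r \<in> {1..card (cands E)} \<and> purchasable E j b r \<noteq> {} \<and>
     (\<forall>r'\<in>{1..<r}. purchasable E j b r' = {})"

text \<open>Equality of prices is expressed by the reverse inequality, so that every condition is a
  comparison \<open>\<le>\<close> of prices as made by the program.\<close>

definition winner :: "'c rel \<Rightarrow> 'c election \<Rightarrow> nat \<Rightarrow> (nat \<Rightarrow> real) \<Rightarrow> nat \<Rightarrow> 'c \<Rightarrow> bool" where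
  "winner tie E j b r c \<longleftrightarrow> c \<in> purchasable E j b r \<and>
     (\<forall>c'\<in>purchasable E j b r. candidate_rho E j b r c \<le> candidate_rho E j b r c' \<and>
        (candidate_rho E j b r c' \<le> candidate_rho E j b r c \<longrightarrow> (c, c') \<in> tie))"

definition pay :: "'c election \<Rightarrow> nat \<Rightarrow> (nat \<Rightarrow> real) \<Rightarrow> nat \<Rightarrow> 'c \<Rightarrow> nat \<Rightarrow> real" where
  "pay E j b r c = (\<lambda>i. if i \<in> supporters E j c r
     then b i - min (candidate_rho E j b r c) (b i) else b i)"

text \<open>This removes the quantification over all real prices: of each candidate only the lowest
  price matters, and that is \<open>candidate_rho\<close>.\<close>

lemma mes_round_iff:
  assumes b: "nonneg_budgets E b"
  shows "mes_round tie E j b c b' \<longleftrightarrow>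
    (\<exists>r. least_cutoff E j b r \<and> winner tie E j b r c \<and> b' = pay E j b r c)"
proof
  assume "mes_round tie E j b c b'"
  then obtain r \<rho> where r: "least_cutoff E j b r" and c: "c \<in> purchasable E j b r"
    and aff: "affordable E j b r \<rho> c"
    and le: "\<And>c' \<rho>'. c' \<in> purchasable E j b r \<Longrightarrow> affordable E j b r \<rho>' c' \<Longrightarrow> \<rho> \<le> \<rho>'"
    and tie: "\<And>c'. c' \<in> purchasable E j b r \<Longrightarrow> affordable E j b r \<rho> c' \<Longrightarrow> (c, c') \<in> tie"
    and b': "b' = (\<lambda>i. if i \<in> supporters E j c r then b i - min \<rho> (b i) else b i)"
    unfolding mes_round_def least_cutoff_def by blast
  have \<rho>: "\<rho> = candidate_rho E j b r c"
    using candidate_rho_le[OF b c aff] le[OF c affordable_candidate_rho[OF b c]] by simp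
  have "candidate_rho E j b r c \<le> candidate_rho E j b r c' \<and>
      (candidate_rho E j b r c' \<le> candidate_rho E j b r c \<longrightarrow> (c, c') \<in> tie)"
    if "c' \<in> purchasable E j b r" for c'
    using le[OF that affordable_candidate_rho[OF b that]] tie[OF that]
      affordable_candidate_rho[OF b that] unfolding \<rho> by (metis order_antisym)
  then show "\<exists>r. least_cutoff E j b r \<and> winner tie E j b r c \<and> b' = pay E j b r c"
    using r c b' unfolding winner_def pay_def \<rho> by blast
next
  assume "\<exists>r. least_cutoff E j b r \<and> winner tie E j b r c \<and> b' = pay E j b r c"
  then obtain r where r: "least_cutoff E j b r" and c: "c \<in> purchasable E j b r"
    and *: "\<And>c'. c' \<in> purchasable E j b r \<Longrightarrow> candidate_rho E j b r c \<le> candidate_rho E j b r c' \<and>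
        (candidate_rho E j b r c' \<le> candidate_rho E j b r c \<longrightarrow> (c, c') \<in> tie)"
    and b': "b' = pay E j b r c"
    unfolding winner_def by blast
  have "candidate_rho E j b r c \<le> \<rho>'"
    if "c' \<in> purchasable E j b r" "affordable E j b r \<rho>' c'" for c' \<rho>'
    using *[OF that(1)] candidate_rho_le[OF b that] by simp
  moreover have "(c, c') \<in> tie"
    if "c' \<in> purchasable E j b r" "affordable E j b r (candidate_rho E j b r c) c'" for c'
    using *[OF that(1)] candidate_rho_le[OF b that] by simp
  ultimately show "mes_round tie E j b c b'"
    unfolding mes_round_def
    using r c affordable_candidate_rho[OF b c] b'
    unfolding least_cutoff_def pay_def
    by (intro exI[of _ r] exI[of _ "candidate_rho E j b r c"]) simp
qed

lemma least_cutoff_unique: "least_cutoff E j b r \<Longrightarrow> least_cutoff E j b r' \<Longrightarrow> r = r'"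
  by (rule linorder_cases[of r r']) (auto simp: least_cutoff_def)

lemma winner_unique:
  assumes "linear_order tie" "winner tie E j b r c" "winner tie E j b r c'"
  shows "c = c'"
  using assms
  unfolding winner_def linear_order_on_def partial_order_on_def antisym_def by blast

lemma mes_round_unique:
  assumes "linear_order tie" "nonneg_budgets E b" "mes_round tie E j b c b'" "mes_round tie E j b d d'"
  shows "c = d \<and> b' = d'"
  using assms(3,4) winner_unique[OF assms(1)] least_cutoff_unique
  unfolding mes_round_iff[OF assms(2)] by metis

lemma linear_order_min:
  assumes "linear_order tie" "finite A" "A \<noteq> {}"
  shows "\<exists>c\<in>A. \<forall>c'\<in>A. (c, c') \<in> tie"
  using assms(2,3)
proof (induction rule: finite_ne_induct)
  case (singleton x)
  then show ?case
    using assms(1) by (auto simp: linear_order_on_def partial_order_on_def preorder_on_def refl_on_def)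
next
  case (insert x F)
  then obtain c where c: "c \<in> F" "\<And>c'. c' \<in> F \<Longrightarrow> (c, c') \<in> tie" by blast
  have refl: "(x, x) \<in> tie" and tr: "trans tie" and tot: "(x, c) \<in> tie \<or> (c, x) \<in> tie"
    using assms(1)
    unfolding linear_order_on_def partial_order_on_def preorder_on_def refl_on_def total_on_def
    by (auto, metis)
  from tot show ?case
  proof
    assume "(x, c) \<in> tie"
    then have "\<forall>c'\<in>insert x F. (x, c') \<in> tie" using c refl tr by (auto dest: transD)
    then show ?thesis by blast
  next
    assume "(c, x) \<in> tie"
    then show ?thesis using c by blast
  qed
qed

lemma winner_exists:
  assumes "linear_order tie" "finite (cands E)" "purchasable E j b r \<noteq> {}"
  shows "\<exists>c. winner tie E j b r c"
proof -
  let ?X = "purchasable E j b r" and ?\<rho> = "candidate_rho E j b r"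
  have fin: "finite ?X" using assms(2) by (simp add: purchasable_def)
  obtain x where x: "x \<in> ?X" "\<And>c. c \<in> ?X \<Longrightarrow> ?\<rho> x \<le> ?\<rho> c"
    using ex_is_arg_min_if_finite[OF fin assms(3), of ?\<rho>] by (auto simp: is_arg_min_linorder)
  have "finite {c \<in> ?X. ?\<rho> c \<le> ?\<rho> x}" "{c \<in> ?X. ?\<rho> c \<le> ?\<rho> x} \<noteq> {}" using fin x(1) by auto
  from linear_order_min[OF assms(1) this] obtain c where
    "c \<in> ?X" "?\<rho> c \<le> ?\<rho> x" "\<And>c'. c' \<in> ?X \<Longrightarrow> ?\<rho> c' \<le> ?\<rho> x \<Longrightarrow> (c, c') \<in> tie"
    by blast
  then have "winner tie E j b r c"
    using x unfolding winner_def by (meson order_trans)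
  then show ?thesis ..
qed

lemma supporters_full:
  assumes "valid_election E" "j \<in> rounds E" "c \<in> cands E"
  shows "supporters E j c (card (cands E)) = voters E"
proof -
  have "top_set E j i (card (cands E)) = cands E" if "i \<in> voters E" for i
  proof -
    have "distinct (pref E j i)" "set (pref E j i) = cands E"
      using assms that by (auto simp: valid_election_def)
    then show ?thesis by (metis top_set_def distinct_card order_refl take_all)
  qed
  then show ?thesis using assms(3) by (auto simp: supporters_def)
qed

text \<open>At the largest cutoff everybody supports every candidate, so a total budget of 1 makes
  all candidates purchasable.\<close>

lemma least_cutoff_exists:
  assumes "valid_election E" "j \<in> rounds E" "sum b (voters E) \<ge> 1"
  shows "\<exists>r. least_cutoff E j b r"
proof -
  define P where "P r \<longleftrightarrow> r \<ge> 1 \<and> purchasable E j b r \<noteq> {}" for r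
  obtain c where c: "c \<in> cands E" and card: "card (cands E) > 0"
    using assms(1) by (auto simp: valid_election_def card_gt_0_iff)
  have "c \<in> purchasable E j b (card (cands E))"
    using c assms(3) supporters_full[OF assms(1,2) c] by (simp add: purchasable_def)
  then have m: "P (card (cands E))" using card by (auto simp: P_def)
  have "least_cutoff E j b (LEAST r. P r)"
    using LeastI[of P, OF m] Least_le[of P, OF m] not_less_Least[of _ P]
    unfolding least_cutoff_def P_def by (meson atLeastAtMost_iff atLeastLessThan_iff)
  then show ?thesis ..
qed

lemma mes_round_exists:
  assumes "linear_order tie" "valid_election E" "j \<in> rounds E" "nonneg_budgets E b"
    "sum b (voters E) \<ge> 1"
  shows "\<exists>c b'. mes_round tie E j b c b'"
proof -
  obtain r where r: "least_cutoff E j b r"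
    using least_cutoff_exists[OF assms(2,3,5)] by blast
  moreover obtain c where "winner tie E j b r c"
    using winner_exists[OF assms(1), of E j b r] r assms(2)
    by (auto simp: least_cutoff_def valid_election_def)
  ultimately show ?thesis unfolding mes_round_iff[OF assms(4)] by blast
qed

text \<open>The claims on budgets hold because the supporters of the winner pay nonnegative amounts,
  never above their budgets, that add up to exactly 1.\<close>

lemma mes_round_budgets:
  assumes b: "nonneg_budgets E b" and round: "mes_round tie E j b c b'"
  shows "nonneg_budgets E b'" "sum b' (voters E) = sum b (voters E) - 1"
    "\<And>S. S \<subseteq> voters E \<Longrightarrow> sum b' S \<ge> sum b S - 1" "c \<in> cands E"
proof -
  obtain r where r: "winner tie E j b r c" and b': "b' = pay E j b r c"
    using round unfolding mes_round_iff[OF b] by blast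
  let ?S = "supporters E j c r" and ?\<rho> = "candidate_rho E j b r c"
  have c: "c \<in> purchasable E j b r" using r by (simp add: winner_def)
  then show "c \<in> cands E" by (simp add: purchasable_def)
  show "nonneg_budgets E b'" using b by (auto simp: nonneg_budgets_def b' pay_def)
  have fin: "finite (voters E)" by (simp add: voters_def)
  have nonneg: "min ?\<rho> (b i) \<ge> 0" if "i \<in> voters E" for i
    using candidate_rho_pos[OF b c] b that by (auto simp: nonneg_budgets_def)
  have eq: "sum b' S = sum b S - (\<Sum>i\<in>S \<inter> ?S. min ?\<rho> (b i))" if "finite S" for S
  proof -
    have "sum b' S = (\<Sum>i\<in>S. b i - (if i \<in> ?S then min ?\<rho> (b i) else 0))"
      by (intro sum.cong) (auto simp: b' pay_def)
    also have "\<dots> = sum b S - (\<Sum>i\<in>S \<inter> ?S. min ?\<rho> (b i))"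
      using that by (simp add: sum_subtractf sum.inter_restrict)
    finally show ?thesis .
  qed
  have one: "(\<Sum>i\<in>?S. min ?\<rho> (b i)) = 1"
    by (rule sum_min_candidate_rho[OF b c])
  show "sum b' (voters E) = sum b (voters E) - 1"
    using eq[OF fin] one supporters_subset[of E j c r] by (simp add: Int_absorb1)
  show "sum b' S \<ge> sum b S - 1" if S: "S \<subseteq> voters E" for S
  proof -
    have "(\<Sum>i\<in>S \<inter> ?S. min ?\<rho> (b i)) \<le> (\<Sum>i\<in>?S. min ?\<rho> (b i))"
      using nonneg[OF supportersD] by (intro sum_mono2) auto
    then show ?thesis using eq[OF finite_subset[OF S fin]] one by simp
  qed
qed

text \<open>\<open>SOME\<close> makes the recursion for the budgets total; within the horizon of a
  valid election the round exists and is unique.\<close>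

definition mes_step :: "'c rel \<Rightarrow> 'c election \<Rightarrow> nat \<Rightarrow> (nat \<Rightarrow> real) \<Rightarrow> 'c \<times> (nat \<Rightarrow> real)" where
  "mes_step tie E j b = (SOME (c, b'). mes_round tie E j b c b')"

primrec budgets :: "'c rel \<Rightarrow> 'c election \<Rightarrow> nat \<Rightarrow> nat \<Rightarrow> real" where
  "budgets tie E 0 = (\<lambda>i. real (horizon E) / real (num_voters E))"
| "budgets tie E (Suc j) = snd (mes_step tie E j (budgets tie E j))"

definition chosen :: "'c rel \<Rightarrow> 'c election \<Rightarrow> nat \<Rightarrow> 'c" where
  "chosen tie E j = fst (mes_step tie E j (budgets tie E j))"

section \<open>The outcome of a valid election and rank-wPJR\<close>

locale mes_election =
  fixes tie :: "'c rel" and E :: "'c election"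
  assumes tie: "linear_order tie" and valid: "valid_election E"
begin

text \<open>The claims are proved together: the total \<open>T - j\<close> is at least 1 before
  round \<open>j\<close>, hence the round exists, hence the total falls by exactly 1.\<close>

lemma budgets_invariant:
  assumes "j \<le> horizon E"
  shows "nonneg_budgets E (budgets tie E j) \<and>
    sum (budgets tie E j) (voters E) = real (horizon E) - real j \<and>
    (\<forall>k<j. mes_round tie E k (budgets tie E k) (chosen tie E k) (budgets tie E (Suc k)))"
  using assms
proof (induction j)
  case 0
  then show ?case using valid by (auto simp: nonneg_budgets_def voters_def valid_election_def)
next
  case (Suc j)
  then have IH: "nonneg_budgets E (budgets tie E j)"
    "sum (budgets tie E j) (voters E) = real (horizon E) - real j"
    and IH': "\<forall>k<j. mes_round tie E k (budgets tie E k) (chosen tie E k) (budgets tie E (Suc k))"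
    by auto
  have "\<exists>c b'. mes_round tie E j (budgets tie E j) c b'"
    using Suc.prems IH by (intro mes_round_exists tie valid) (auto simp: rounds_def)
  then have "\<exists>x. case x of (c, b') \<Rightarrow> mes_round tie E j (budgets tie E j) c b'"
    by blast
  then have "case mes_step tie E j (budgets tie E j) of (c, b') \<Rightarrow> mes_round tie E j (budgets tie E j) c b'"
    unfolding mes_step_def by (rule someI_ex)
  then have round: "mes_round tie E j (budgets tie E j) (chosen tie E j) (budgets tie E (Suc j))"
    by (simp add: chosen_def case_prod_beta)
  have "sum (budgets tie E (Suc j)) (voters E) = real (horizon E) - real (Suc j)"
    unfolding mes_round_budgets(2)[OF IH(1) round] IH(2) by simp
  then show ?case
    using mes_round_budgets(1)[OF IH(1) round] round IH' unfolding less_Suc_eq by blast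
qed

lemma nonneg_budgets: "j \<le> horizon E \<Longrightarrow> nonneg_budgets E (budgets tie E j)"
  and mes_round: "j < horizon E \<Longrightarrow>
    mes_round tie E j (budgets tie E j) (chosen tie E j) (budgets tie E (Suc j))"
  using budgets_invariant[of j] budgets_invariant[of "Suc j"] by auto

lemma mes_round_prefix:
  assumes "b 0 = (\<lambda>i. real (horizon E) / real (num_voters E))"
    "\<forall>k<j. mes_round tie E k (b k) (w k) (b (Suc k))" "j \<le> horizon E"
  shows "b j = budgets tie E j \<and> (\<forall>k<j. w k = chosen tie E k)"
  using assms(2,3)
proof (induction j)
  case 0
  then show ?case using assms(1) by simp
next
  case (Suc j)
  then have "b j = budgets tie E j" "\<forall>k<j. w k = chosen tie E k" by auto
  moreover from this have "w j = chosen tie E j \<and> b (Suc j) = budgets tie E (Suc j)"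
    using mes_round_unique[OF tie nonneg_budgets[of j] _ mes_round[of j]] Suc.prems by (metis Suc_leD Suc_le_lessD lessI)
  ultimately show ?case by (auto simp: less_Suc_eq)
qed

lemma mes_outcome_iff: "mes_outcome tie E W \<longleftrightarrow> W = map (chosen tie E) [0..<horizon E]"
proof
  assume "mes_outcome tie E W"
  then obtain b where len: "length W = horizon E"
    and b: "b 0 = (\<lambda>i. real (horizon E) / real (num_voters E))"
      "\<forall>j\<in>rounds E. mes_round tie E j (b j) (W ! j) (b (Suc j))"
    unfolding mes_outcome_def by blast
  have "\<forall>k<horizon E. W ! k = chosen tie E k"
    using mes_round_prefix[where b = b and w = "\<lambda>k. W ! k" and j = "horizon E"] b by (auto simp: rounds_def)
  then show "W = map (chosen tie E) [0..<horizon E]" using len by (intro nth_equalityI) auto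
next
  assume "W = map (chosen tie E) [0..<horizon E]"
  then show "mes_outcome tie E W"
    unfolding mes_outcome_def using mes_round
    by (intro conjI exI[of _ "budgets tie E"]) (auto simp: rounds_def)
qed

lemma mes_eq: "mes tie E = map (chosen tie E) [0..<horizon E]"
  unfolding mes_def mes_outcome_iff by simp

lemma chosen_in_cands: "j < horizon E \<Longrightarrow> chosen tie E j \<in> cands E"
  using mes_round_budgets(4)[OF nonneg_budgets mes_round] by simp

text \<open>
  As long as the group still has a budget of 1, it can afford any of its common candidates. Hence
  it pays only in rounds whose winner is approved by one of its members, and at most 1 each time.
\<close>

lemma rank_wPJR_mes: "rank_wPJR E (mes tie E)"
  unfolding rank_wPJR_def
proof (intro allI impI, rule ccontr)
  fix r :: "nat \<Rightarrow> nat" and l S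
  assume r: "\<forall>j\<in>rounds E. r j \<in> {1..card (cands E)}" and l: "l \<ge> 1" and S: "S \<noteq> {}" "S \<subseteq> voters E"
    and large: "real (card S) \<ge> real l * real (num_voters E) / real (horizon E)"
    and common: "\<forall>j\<in>rounds E. (\<Inter>i\<in>S. top_set E j i (r j)) \<noteq> {}"
  define good where "good j \<longleftrightarrow> mes tie E ! j \<in> (\<Union>i\<in>S. top_set E j i (r j))" for j
  assume "\<not> l \<le> card {j \<in> rounds E. mes tie E ! j \<in> (\<Union>i\<in>S. top_set E j i (r j))}"
  then have few: "card {j. j < horizon E \<and> good j} < l" by (simp add: rounds_def good_def)
  have pos: "num_voters E > 0" "horizon E > 0" using valid by (auto simp: valid_election_def)
  have "sum (budgets tie E j) S \<ge> real l - real (card {k. k < j \<and> good k})" if "j \<le> horizon E" for j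
    using that
  proof (induction j)
    case 0
    then show ?case using large pos by (simp add: field_simps)
  next
    case (Suc j)
    let ?b = "budgets tie E j" and ?c = "chosen tie E j"
    have j: "j < horizon E" using Suc.prems by simp
    have nonneg: "nonneg_budgets E ?b" using nonneg_budgets j by simp
    have IH: "sum ?b S \<ge> real l - real (card {k. k < j \<and> good k})" using Suc by simp
    show ?case
    proof (cases "good j")
      case True
      then have "{k. k < Suc j \<and> good k} = insert j {k. k < j \<and> good k}" by (auto simp: less_Suc_eq)
      then have "card {k. k < Suc j \<and> good k} = Suc (card {k. k < j \<and> good k})" by simp
      then show ?thesis using mes_round_budgets(3)[OF nonneg mes_round[OF j] S(2)] IH by simp
    next
      case False
      obtain r' where cut: "least_cutoff E j ?b r'" and pay: "budgets tie E (Suc j) = pay E j ?b r' ?c"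
        using mes_round[OF j] unfolding mes_round_iff[OF nonneg] by blast
      obtain c where c: "c \<in> (\<Inter>i\<in>S. top_set E j i (r j))"
        using common j unfolding rounds_def by blast
      have "card {k. k < j \<and> good k} \<le> card {k. k < horizon E \<and> good k}"
        using j by (intro card_mono) auto
      \<comment> \<open>Integrality: fewer than \<open>l\<close> good rounds are at most
        \<open>l - 1\<close>, so the group still owns a full unit.\<close>
      then have "1 \<le> sum ?b S" using few IH by linarith
      also have "S \<subseteq> supporters E j c (r j)"
        using c S by (auto simp: supporters_def)
      then have "sum ?b S \<le> sum ?b (supporters E j c (r j))"
        using nonneg by (intro sum_mono2) (auto simp: nonneg_budgets_def dest: supportersD)
      finally have "1 \<le> sum ?b (supporters E j c (r j))" .
      moreover have "c \<in> cands E"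
      proof -
        obtain i where "i \<in> S" using S by blast
        then have "c \<in> set (pref E j i)" using c by (auto simp: top_set_def dest: in_set_takeD)
        then show ?thesis using valid j \<open>i \<in> S\<close> S(2) by (auto simp: valid_election_def rounds_def)
      qed
      ultimately have "purchasable E j ?b (r j) \<noteq> {}" by (auto simp: purchasable_def)
      then have "r' \<le> r j"
        using cut r j unfolding least_cutoff_def rounds_def
        by (metis atLeastAtMost_iff atLeastLessThan_iff lessThan_iff not_less)
      \<comment> \<open>A winner outside the top sets at cutoff \<open>r j\<close> is also outside
        those at the smaller cutoff \<open>r'\<close>.\<close>
      have "i \<notin> supporters E j ?c r'" if "i \<in> S" for i
        using False that supporters_mono[OF \<open>r' \<le> r j\<close>, of E j ?c] j
        by (auto simp: good_def mes_eq supporters_def)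
      then have "sum (budgets tie E (Suc j)) S = sum ?b S"
        unfolding pay pay_def by (intro sum.cong) auto
      moreover have "{k. k < Suc j \<and> good k} = {k. k < j \<and> good k}"
        using False by (auto simp: less_Suc_eq)
      ultimately show ?thesis using IH by simp
    qed
  qed
  from this[of "horizon E"] have "sum (budgets tie E (horizon E)) S \<ge> 1" using few by linarith
  moreover have "sum (budgets tie E (horizon E)) S \<le> sum (budgets tie E (horizon E)) (voters E)"
    using S nonneg_budgets[of "horizon E"] by (intro sum_mono2) (auto simp: voters_def nonneg_budgets_def)
  ultimately show False using budgets_invariant[of "horizon E"] by simp
qed

end

section \<open>Dependence on the past only\<close>

lemma mes_round_cong:
  assumes "voters E = voters E'" "cands E = cands E'" "\<forall>i\<in>voters E. pref E j i = pref E' j i"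
  shows "mes_round tie E j = mes_round tie E' j"
proof -
  have "supporters E j = supporters E' j"
    using assms by (auto simp: fun_eq_iff supporters_def top_set_def)
  then show ?thesis
    using assms(2) by (simp add: fun_eq_iff mes_round_def purchasable_def affordable_def)
qed

text \<open>Up to round \<open>j\<close> both elections have the same relation
  \<open>mes_round\<close>, so \<open>SOME\<close> makes the same choice in both and the executions
  coincide.\<close>

lemma semi_online_mes:
  fixes tie :: "'c rel"
  assumes "linear_order tie"
  shows "semi_online (mes tie)"
  unfolding semi_online_def
proof (intro conjI allI impI)
  fix E :: "'c election" assume "valid_election E"
  then interpret mes_election tie E using assms by unfold_locales
  show "mes tie E \<in> sequences E"
    using chosen_in_cands by (auto simp: mes_eq sequences_def)
next
  fix E E' :: "'c election" and j
  assume E: "valid_election E" and E': "valid_election E'"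
    and same: "num_voters E = num_voters E'" "cands E = cands E'" "horizon E = horizon E'"
    and j: "j \<in> rounds E" and prefs: "\<forall>k\<le>j. \<forall>i\<in>voters E. pref E k i = pref E' k i"
  interpret mes_election tie E using E assms by unfold_locales
  interpret E': mes_election tie E' using E' assms by unfold_locales
  have "mes_round tie E k = mes_round tie E' k" if "k \<le> j" for k
    using same prefs that by (intro mes_round_cong) (auto simp: voters_def)
  then have step: "mes_step tie E k = mes_step tie E' k" if "k \<le> j" for k
    using that by (simp add: mes_step_def fun_eq_iff)
  have "budgets tie E k = budgets tie E' k" if "k \<le> j" for k
    using that by (induction k) (simp_all add: same step)
  then show "mes tie E ! j = mes tie E' ! j"
    using j same step by (simp add: mes_eq E'.mes_eq chosen_def rounds_def)
qed

section \<open>The MES rule on integers\<close>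

text \<open>
  Behind the input lie rows of \<open>n + 2\<close> cells. In row \<open>j\<close>, cell \<open>i < n\<close> divided by cell \<open>n\<close> is the
  budget of voter \<open>i\<close> before round \<open>j\<close>, and cell \<open>n + 1\<close> is the winner of round \<open>j - 1\<close>.
  Candidates are represented by their position \<open>p\<close> in the tie-breaking order, and \<open>r\<close> stands for
  the cutoff \<open>r + 1\<close>.
\<close>

definition pref_cell :: "nat \<Rightarrow> nat \<Rightarrow> nat \<Rightarrow> nat \<Rightarrow> nat \<Rightarrow> nat" where
  "pref_cell n m j i q = 3 + m + (j * (n * m) + (i * m + q))"

definition row_cell :: "nat \<Rightarrow> nat \<Rightarrow> nat \<Rightarrow> nat \<Rightarrow> nat \<Rightarrow> nat" where
  "row_cell n m T j x = 3 + m + T * (n * m) + (j * (n + 2) + x)"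

text \<open>The cutoff is \<open>r + 1\<close>, which is not a variable; hence the search runs over
  all \<open>m\<close> positions with a guard.\<close>

definition supports :: "(nat \<Rightarrow> nat) \<Rightarrow> nat \<Rightarrow> nat \<Rightarrow> nat \<Rightarrow> nat \<Rightarrow> nat \<Rightarrow> nat \<Rightarrow> bool" where
  "supports M n m j r p i \<longleftrightarrow> (\<exists>q<m. q \<le> r \<and> M (pref_cell n m j i q) = M (3 + p))"

text \<open>Cell \<open>n\<close> holds the common denominator \<open>D\<close>, so on the scale of
  the numerators it stands for the cost 1 of a candidate.\<close>

definition can_buy :: "(nat \<Rightarrow> nat) \<Rightarrow> nat \<Rightarrow> nat \<Rightarrow> nat \<Rightarrow> nat \<Rightarrow> nat \<Rightarrow> nat \<Rightarrow> bool" where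
  "can_buy M n m T j r p \<longleftrightarrow>
     M (row_cell n m T j n) \<le> (\<Sum>i<n. if supports M n m j r p i then M (row_cell n m T j i) else 0)"

definition is_poor :: "(nat \<Rightarrow> nat) \<Rightarrow> nat \<Rightarrow> nat \<Rightarrow> nat \<Rightarrow> nat \<Rightarrow> nat \<Rightarrow> nat \<Rightarrow> nat \<Rightarrow> bool" where
  "is_poor M n m T j r p i \<longleftrightarrow> supports M n m j r p i \<and>
     (\<Sum>i'<n. if supports M n m j r p i'
        then min (M (row_cell n m T j i)) (M (row_cell n m T j i')) else 0) < M (row_cell n m T j n)"

text \<open>The lowest price of the candidate is \<open>rho_num / (D * rho_den)\<close>, where
  \<open>D\<close> is the content of cell \<open>n\<close>.\<close>

definition rho_num :: "(nat \<Rightarrow> nat) \<Rightarrow> nat \<Rightarrow> nat \<Rightarrow> nat \<Rightarrow> nat \<Rightarrow> nat \<Rightarrow> nat \<Rightarrow> nat" where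
  "rho_num M n m T j r p =
     M (row_cell n m T j n) - (\<Sum>i<n. if is_poor M n m T j r p i then M (row_cell n m T j i) else 0)"

definition rho_den :: "(nat \<Rightarrow> nat) \<Rightarrow> nat \<Rightarrow> nat \<Rightarrow> nat \<Rightarrow> nat \<Rightarrow> nat \<Rightarrow> nat \<Rightarrow> nat" where
  "rho_den M n m T j r p =
     (\<Sum>i<n. if supports M n m j r p i \<and> \<not> is_poor M n m T j r p i then 1 else 0)"

text \<open>The machine cannot multiply, and only variables may bound a loop.\<close>

definition times_le :: "nat \<Rightarrow> nat \<Rightarrow> nat \<Rightarrow> nat" where
  "times_le n a k = (\<Sum>x<n. if x < k then a else 0)"

text \<open>Two prices compared by cross-multiplication. Their common factor \<open>D\<close>
  cancels, and the remaining denominators count voters, so they are at most \<open>n\<close> as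
  \<open>times_le\<close> needs.\<close>

definition rho_le :: "(nat \<Rightarrow> nat) \<Rightarrow> nat \<Rightarrow> nat \<Rightarrow> nat \<Rightarrow> nat \<Rightarrow> nat \<Rightarrow> nat \<Rightarrow> nat \<Rightarrow> bool" where
  "rho_le M n m T j r p p' \<longleftrightarrow>
     times_le n (rho_num M n m T j r p) (rho_den M n m T j r p')
       \<le> times_le n (rho_num M n m T j r p') (rho_den M n m T j r p)"

definition selected :: "(nat \<Rightarrow> nat) \<Rightarrow> nat \<Rightarrow> nat \<Rightarrow> nat \<Rightarrow> nat \<Rightarrow> nat \<Rightarrow> nat \<Rightarrow> bool" where
  "selected M n m T j r p \<longleftrightarrow> can_buy M n m T j r p \<and>
     (\<forall>r'<m. r' < r \<longrightarrow> (\<forall>p'<m. \<not> can_buy M n m T j r' p')) \<and>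
     (\<forall>p'<m. can_buy M n m T j r p' \<longrightarrow>
        rho_le M n m T j r p p' \<and> (rho_le M n m T j r p' p \<longrightarrow> p \<le> p'))"

text \<open>A definite description in the form of a sum: exactly one pair is selected in a round,
  and only its term survives.\<close>

definition at_selected ::
  "(nat \<Rightarrow> nat) \<Rightarrow> nat \<Rightarrow> nat \<Rightarrow> nat \<Rightarrow> nat \<Rightarrow> (nat \<Rightarrow> nat \<Rightarrow> nat) \<Rightarrow> nat" where
  "at_selected M n m T j f = (\<Sum>r<m. \<Sum>p<m. if selected M n m T j r p then f r p else 0)"

text \<open>With \<open>K\<close> for \<open>rho_den\<close> and \<open>N\<close> for
  \<open>rho_num\<close>, a supporter is left with \<open>B/D - N/(D*K) = (B*K - N)/(D*K)\<close>.
  For a supporter who cannot afford the price, truncation gives the correct remainder 0.\<close>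

definition next_budget :: "(nat \<Rightarrow> nat) \<Rightarrow> nat \<Rightarrow> nat \<Rightarrow> nat \<Rightarrow> nat \<Rightarrow> nat \<Rightarrow> nat" where
  "next_budget M n m T j i = at_selected M n m T j (\<lambda>r p.
     times_le n (M (row_cell n m T j i)) (rho_den M n m T j r p) -
     (if supports M n m j r p i then rho_num M n m T j r p else 0))"

definition next_scale :: "(nat \<Rightarrow> nat) \<Rightarrow> nat \<Rightarrow> nat \<Rightarrow> nat \<Rightarrow> nat \<Rightarrow> nat" where
  "next_scale M n m T j = at_selected M n m T j (\<lambda>r p.
     times_le n (M (row_cell n m T j n)) (rho_den M n m T j r p))"

definition next_winner :: "(nat \<Rightarrow> nat) \<Rightarrow> nat \<Rightarrow> nat \<Rightarrow> nat \<Rightarrow> nat \<Rightarrow> nat" where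
  "next_winner M n m T j = at_selected M n m T j (\<lambda>r p. M (3 + p))"

definition init_row :: "nat \<Rightarrow> nat \<Rightarrow> nat \<Rightarrow> (nat \<Rightarrow> nat) \<Rightarrow> nat \<Rightarrow> nat" where
  "init_row n m T M =
     (fold (\<lambda>i M. M(row_cell n m T 0 i := T)) [0..<n] M)(row_cell n m T 0 n := n)"

definition round_budgets :: "nat \<Rightarrow> nat \<Rightarrow> nat \<Rightarrow> nat \<Rightarrow> (nat \<Rightarrow> nat) \<Rightarrow> nat \<Rightarrow> nat" where
  "round_budgets n m T j M =
     fold (\<lambda>i M. M(row_cell n m T (Suc j) i := next_budget M n m T j i)) [0..<n] M"

definition round_scale :: "nat \<Rightarrow> nat \<Rightarrow> nat \<Rightarrow> nat \<Rightarrow> (nat \<Rightarrow> nat) \<Rightarrow> nat \<Rightarrow> nat" where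
  "round_scale n m T j M = M(row_cell n m T (Suc j) n := next_scale M n m T j)"

definition round_winner :: "nat \<Rightarrow> nat \<Rightarrow> nat \<Rightarrow> nat \<Rightarrow> (nat \<Rightarrow> nat) \<Rightarrow> nat \<Rightarrow> nat" where
  "round_winner n m T j M = M(row_cell n m T (Suc j) (n + 1) := next_winner M n m T j)"

definition all_rounds :: "nat \<Rightarrow> nat \<Rightarrow> nat \<Rightarrow> (nat \<Rightarrow> nat) \<Rightarrow> nat \<Rightarrow> nat" where
  "all_rounds n m T M =
     fold (\<lambda>j M. round_winner n m T j (round_scale n m T j (round_budgets n m T j M))) [0..<T] M"

text \<open>The winners are kept in the rows until the end because the first cells, where the output
  belongs, still hold input that the rounds read.\<close>

definition write_output :: "nat \<Rightarrow> nat \<Rightarrow> nat \<Rightarrow> (nat \<Rightarrow> nat) \<Rightarrow> nat \<Rightarrow> nat" where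
  "write_output n m T M = fold (\<lambda>j M. M(j := M (row_cell n m T (Suc j) (n + 1)))) [0..<T] M"

definition mes_program :: "nat \<Rightarrow> nat \<Rightarrow> nat \<Rightarrow> (nat \<Rightarrow> nat) \<Rightarrow> nat \<Rightarrow> nat" where
  "mes_program n m T M = write_output n m T (all_rounds n m T (init_row n m T M))"

section \<open>Computability of the integer algorithm\<close>

lemma computable_supports [computable]:
  "computable_cond (\<lambda>\<sigma> M. supports M (\<sigma> n) (\<sigma> m) (\<sigma> j) (\<sigma> r) (\<sigma> p) (\<sigma> i))"
  unfolding supports_def pref_cell_def by (intro computable)

lemma computable_row_cell [computable]:
  assumes "computable_exp f"
  shows "computable_exp (\<lambda>\<sigma> M. row_cell (\<sigma> n) (\<sigma> m) (\<sigma> T) (\<sigma> j) (f \<sigma> M))"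
  unfolding row_cell_def by (intro computable assms)

text \<open>A successor is no variable and cannot be a factor in \<open>computable_times\<close>;
  \<open>mult_Suc\<close> leaves a product with \<open>\<sigma> j\<close>.\<close>

lemma computable_row_cell_Suc [computable]:
  assumes "computable_exp f"
  shows "computable_exp (\<lambda>\<sigma> M. row_cell (\<sigma> n) (\<sigma> m) (\<sigma> T) (Suc (\<sigma> j)) (f \<sigma> M))"
  unfolding row_cell_def mult_Suc by (intro computable assms)

lemma computable_row_cell_0 [computable]:
  assumes "computable_exp f"
  shows "computable_exp (\<lambda>\<sigma> M. row_cell (\<sigma> n) (\<sigma> m) (\<sigma> T) 0 (f \<sigma> M))"
  unfolding row_cell_def mult_0 by (intro computable assms)

lemma computable_can_buy [computable]:
  "computable_cond (\<lambda>\<sigma> M. can_buy M (\<sigma> n) (\<sigma> m) (\<sigma> T) (\<sigma> j) (\<sigma> r) (\<sigma> p))"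
  unfolding can_buy_def by (intro computable)

lemma computable_is_poor [computable]:
  "computable_cond (\<lambda>\<sigma> M. is_poor M (\<sigma> n) (\<sigma> m) (\<sigma> T) (\<sigma> j) (\<sigma> r) (\<sigma> p) (\<sigma> i))"
  unfolding is_poor_def by (intro computable)

lemma computable_rho_num [computable]:
  "computable_exp (\<lambda>\<sigma> M. rho_num M (\<sigma> n) (\<sigma> m) (\<sigma> T) (\<sigma> j) (\<sigma> r) (\<sigma> p))"
  unfolding rho_num_def by (intro computable)

lemma computable_rho_den [computable]:
  "computable_exp (\<lambda>\<sigma> M. rho_den M (\<sigma> n) (\<sigma> m) (\<sigma> T) (\<sigma> j) (\<sigma> r) (\<sigma> p))"
  unfolding rho_den_def by (intro computable)

lemma computable_rho_le [computable]:
  "computable_cond (\<lambda>\<sigma> M. rho_le M (\<sigma> n) (\<sigma> m) (\<sigma> T) (\<sigma> j) (\<sigma> r) (\<sigma> p) (\<sigma> p'))"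
  unfolding rho_le_def times_le_def by (intro computable)

lemma computable_selected [computable]:
  "computable_cond (\<lambda>\<sigma> M. selected M (\<sigma> n) (\<sigma> m) (\<sigma> T) (\<sigma> j) (\<sigma> r) (\<sigma> p))"
  unfolding selected_def by (intro computable)

lemma computable_next_budget [computable]:
  "computable_exp (\<lambda>\<sigma> M. next_budget M (\<sigma> n) (\<sigma> m) (\<sigma> T) (\<sigma> j) (\<sigma> i))"
  unfolding next_budget_def at_selected_def times_le_def by (intro computable)

lemma computable_next_scale [computable]:
  "computable_exp (\<lambda>\<sigma> M. next_scale M (\<sigma> n) (\<sigma> m) (\<sigma> T) (\<sigma> j))"
  unfolding next_scale_def at_selected_def times_le_def by (intro computable)

lemma computable_next_winner [computable]:
  "computable_exp (\<lambda>\<sigma> M. next_winner M (\<sigma> n) (\<sigma> m) (\<sigma> T) (\<sigma> j))"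
  unfolding next_winner_def at_selected_def by (intro computable)

lemma computable_init_row:
  "computable_cmd (\<lambda>\<sigma> M. init_row (\<sigma> n) (\<sigma> m) (\<sigma> T) M)"
  unfolding init_row_def
  by (rule computable_then[where G = "\<lambda>\<sigma> M. M(row_cell (\<sigma> n) (\<sigma> m) (\<sigma> T) 0 (\<sigma> n) := \<sigma> n)"
        and F = "\<lambda>\<sigma> M. fold (\<lambda>i M. M(row_cell (\<sigma> n) (\<sigma> m) (\<sigma> T) 0 i := \<sigma> T)) [0..<\<sigma> n] M"])
    (intro computable)+

lemma computable_round:
  "computable_cmd (\<lambda>\<sigma> M. round_budgets (\<sigma> n) (\<sigma> m) (\<sigma> T) (\<sigma> j) M)"
  "computable_cmd (\<lambda>\<sigma> M. round_scale (\<sigma> n) (\<sigma> m) (\<sigma> T) (\<sigma> j) M)"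
  "computable_cmd (\<lambda>\<sigma> M. round_winner (\<sigma> n) (\<sigma> m) (\<sigma> T) (\<sigma> j) M)"
  unfolding round_budgets_def round_scale_def round_winner_def by (intro computable)+

lemma computable_all_rounds:
  "computable_cmd (\<lambda>\<sigma> M. all_rounds (\<sigma> n) (\<sigma> m) (\<sigma> T) M)"
proof -
  have 1: "computable_cmd (\<lambda>\<sigma> M. round_scale (\<sigma> n) (\<sigma> m) (\<sigma> T) (\<sigma> j)
      (round_budgets (\<sigma> n) (\<sigma> m) (\<sigma> T) (\<sigma> j) M))" for n m T j
    by (rule computable_then[where F = "\<lambda>\<sigma> M. round_budgets (\<sigma> n) (\<sigma> m) (\<sigma> T) (\<sigma> j) M"
          and G = "\<lambda>\<sigma> M. round_scale (\<sigma> n) (\<sigma> m) (\<sigma> T) (\<sigma> j) M", OF computable_round(1,2)])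
  have "computable_cmd (\<lambda>\<sigma> M. round_winner (\<sigma> n) (\<sigma> m) (\<sigma> T) (\<sigma> j)
      (round_scale (\<sigma> n) (\<sigma> m) (\<sigma> T) (\<sigma> j)
        (round_budgets (\<sigma> n) (\<sigma> m) (\<sigma> T) (\<sigma> j) M)))" for n m T j
    by (rule computable_then[where F = "\<lambda>\<sigma> M. round_scale (\<sigma> n) (\<sigma> m) (\<sigma> T) (\<sigma> j)
            (round_budgets (\<sigma> n) (\<sigma> m) (\<sigma> T) (\<sigma> j) M)"
          and G = "\<lambda>\<sigma> M. round_winner (\<sigma> n) (\<sigma> m) (\<sigma> T) (\<sigma> j) M", OF 1 computable_round(3)])
  then show ?thesis
    unfolding all_rounds_def
    by (intro computable_for[where F = "\<lambda>\<sigma> j M. round_winner (\<sigma> n) (\<sigma> m) (\<sigma> T) j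
      (round_scale (\<sigma> n) (\<sigma> m) (\<sigma> T) j (round_budgets (\<sigma> n) (\<sigma> m) (\<sigma> T) j M))"])
qed

lemma computable_write_output:
  "computable_cmd (\<lambda>\<sigma> M. write_output (\<sigma> n) (\<sigma> m) (\<sigma> T) M)"
  unfolding write_output_def by (intro computable)

lemma computable_mes_program:
  "computable_cmd (\<lambda>\<sigma> M. mes_program (\<sigma> n) (\<sigma> m) (\<sigma> T) M)"
proof -
  have "computable_cmd (\<lambda>\<sigma> M. all_rounds (\<sigma> n) (\<sigma> m) (\<sigma> T) (init_row (\<sigma> n) (\<sigma> m) (\<sigma> T) M))"
    by (rule computable_then[where F = "\<lambda>\<sigma> M. init_row (\<sigma> n) (\<sigma> m) (\<sigma> T) M"
          and G = "\<lambda>\<sigma> M. all_rounds (\<sigma> n) (\<sigma> m) (\<sigma> T) M", OF computable_init_row computable_all_rounds])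
  then show ?thesis
    unfolding mes_program_def
    by (rule computable_then[where F = "\<lambda>\<sigma> M. all_rounds (\<sigma> n) (\<sigma> m) (\<sigma> T) (init_row (\<sigma> n) (\<sigma> m) (\<sigma> T) M)"
          and G = "\<lambda>\<sigma> M. write_output (\<sigma> n) (\<sigma> m) (\<sigma> T) M", OF _ computable_write_output])
qed

section \<open>Correctness of the program\<close>

lemma times_le_eq: "k \<le> n \<Longrightarrow> times_le n a k = a * k"
proof -
  assume "k \<le> n"
  then have "{x \<in> {..<n}. x < k} = {..<k}" by auto
  then show ?thesis by (simp add: times_le_def sum.inter_filter[symmetric])
qed

lemma at_selected_eq:
  assumes "r0 < m" "p0 < m"
    "\<And>r p. r < m \<Longrightarrow> p < m \<Longrightarrow> selected M n m T j r p \<longleftrightarrow> r = r0 \<and> p = p0"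
  shows "at_selected M n m T j f = f r0 p0"
proof -
  have "at_selected M n m T j f = (\<Sum>r<m. if r = r0 then \<Sum>p<m. if p = p0 then f r0 p0 else 0 else 0)"
    unfolding at_selected_def using assms(3) by (intro sum.cong refl) (auto intro!: sum.cong)
  then show ?thesis using assms(1,2) by (simp add: sum.delta)
qed

lemma length_concat_map_upt:
  assumes "\<And>j. j < k \<Longrightarrow> length (f j) = w"
  shows "length (concat (map f [0..<k])) = k * w"
  using assms by (induction k) auto

lemma nth_concat_map_upt:
  assumes "\<And>j. j < k \<Longrightarrow> length (f j) = w" "j < k" "x < w"
  shows "concat (map f [0..<k]) ! (j * w + x) = f j ! x"
  using assms(1,2)
proof (induction k)
  case (Suc k)
  have len: "length (concat (map f [0..<k])) = k * w"
    using Suc.prems by (intro length_concat_map_upt) auto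
  show ?case
  proof (cases "j < k")
    case True
    then have "Suc j * w \<le> k * w" by (intro mult_le_mono1) simp
    then have "j * w + x < k * w" using assms(3) by simp
    then show ?thesis using Suc True len by (simp add: nth_append)
  next
    case False
    then have "j = k" using Suc.prems by simp
    then show ?thesis using len by (simp add: nth_append)
  qed
qed simp

lemma fold_upt_invariant:
  assumes "I 0 M" "\<And>i M. i < k \<Longrightarrow> I i M \<Longrightarrow> I (Suc i) (F i M)"
  shows "I k (fold F [0..<k] M)"
  using assms by (induction k) auto

lemma pref_cell_less:
  assumes "j < T" "i < n" "q < m"
  shows "pref_cell n m j i q < 3 + m + T * (n * m)"
proof -
  have "Suc i * m \<le> n * m" "Suc j * (n * m) \<le> T * (n * m)"
    using assms by (intro mult_le_mono1; simp)+
  then show ?thesis using assms(3) by (simp add: pref_cell_def)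
qed

lemma row_cell_less:
  assumes "j < j'" "x < n + 2"
  shows "row_cell n m T j x < row_cell n m T j' x'"
proof -
  have "Suc j * (n + 2) \<le> j' * (n + 2)" using assms by (intro mult_le_mono1) simp
  then show ?thesis using assms(2) by (simp add: row_cell_def)
qed

lemma row_cell_eq_iff [simp]: "row_cell n m T j x = row_cell n m T j x' \<longleftrightarrow> x = x'"
  by (simp add: row_cell_def)

lemma input_cell_less_row_cell: "a < 3 + m + T * (n * m) \<Longrightarrow> a < row_cell n m T j x"
  by (simp add: row_cell_def)

section \<open>Elections represented in memory\<close>

locale mes_instance = mes_election tie E for tie :: "'c rel" and E :: "'c election" +
  fixes cs :: "'c list" and \<nu> :: "'c \<Rightarrow> nat"
  assumes cs: "lists_in_order tie (cands E) cs"
    and \<nu>: "bij_betw \<nu> (cands E) {..<card (cands E)}"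
begin

abbreviation "n \<equiv> num_voters E"
abbreviation "m \<equiv> card (cands E)"
abbreviation "T \<equiv> horizon E"

lemma length_cs [simp]: "length cs = m"
  using cs distinct_card by (fastforce simp: lists_in_order_def)

lemma cs_in_cands [simp]: "p < m \<Longrightarrow> cs ! p \<in> cands E"
  using cs length_cs nth_mem by (fastforce simp: lists_in_order_def)

lemma cs_nth_eq_iff: "p < m \<Longrightarrow> p' < m \<Longrightarrow> cs ! p = cs ! p' \<longleftrightarrow> p = p'"
  using cs by (simp add: lists_in_order_def nth_eq_iff_index_eq)

lemma cands_cs: "c \<in> cands E \<Longrightarrow> \<exists>p<m. c = cs ! p"
  using cs length_cs by (metis in_set_conv_nth lists_in_order_def)

text \<open>The list being sorted gives one direction; antisymmetry and distinctness give the
  other.\<close>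

lemma tie_cs_iff:
  assumes "p < m" "p' < m"
  shows "(cs ! p, cs ! p') \<in> tie \<longleftrightarrow> p \<le> p'"
proof -
  have less: "(cs ! a, cs ! b) \<in> tie" if "a < b" "b < m" for a b
    using cs that by (simp add: lists_in_order_def sorted_wrt_iff_nth_less)
  have "antisym tie" "(x, x) \<in> tie" for x
    using tie by (auto simp: linear_order_on_def partial_order_on_def preorder_on_def refl_on_def)
  then show ?thesis
    using less[of p p'] less[of p' p] assms cs_nth_eq_iff[of p p']
    by (metis antisymD linorder_le_less_linear order_le_less)
qed

lemma pref_valid:
  assumes "j < T" "i < n"
  shows "length (pref E j i) = m" "set (pref E j i) = cands E"
proof -
  have "distinct (pref E j i)" "set (pref E j i) = cands E"
    using assms valid by (auto simp: valid_election_def voters_def rounds_def)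
  then show "length (pref E j i) = m" "set (pref E j i) = cands E"
    using distinct_card by fastforce+
qed

lemma \<nu>_eq_iff: "c \<in> cands E \<Longrightarrow> c' \<in> cands E \<Longrightarrow> \<nu> c = \<nu> c' \<longleftrightarrow> c = c'"
  using \<nu> by (auto simp: bij_betw_def inj_on_def)

definition input_ok :: "(nat \<Rightarrow> nat) \<Rightarrow> bool" where
  "input_ok M \<longleftrightarrow> (\<forall>p<m. M (3 + p) = \<nu> (cs ! p)) \<and>
     (\<forall>j<T. \<forall>i<n. \<forall>q<m. M (pref_cell n m j i q) = \<nu> (pref E j i ! q))"

definition row_ok :: "(nat \<Rightarrow> nat) \<Rightarrow> nat \<Rightarrow> nat \<Rightarrow> bool" where
  "row_ok M j D \<longleftrightarrow> D > 0 \<and> M (row_cell n m T j n) = D \<and>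
     (\<forall>i<n. real (M (row_cell n m T j i)) = budgets tie E j i * real D)"

end

text \<open>The memory is a parameter because the facts are needed for every intermediate memory of
  round \<open>j\<close>, not only for the one at its start.\<close>

locale mes_row = mes_instance tie E cs \<nu> for tie :: "'c rel" and E cs \<nu> +
  fixes M :: "nat \<Rightarrow> nat" and j D :: nat
  assumes input: "input_ok M" and row: "row_ok M j D" and j: "j < T"
begin

abbreviation "b \<equiv> budgets tie E j"
abbreviation "B i \<equiv> M (row_cell n m T j i)"
abbreviation "S r p \<equiv> supporters E j (cs ! p) (Suc r)"

lemma D: "D > 0" "M (row_cell n m T j n) = D"
  and B: "i < n \<Longrightarrow> real (B i) = b i * real D"
  using row by (auto simp: row_ok_def)

lemma b: "nonneg_budgets E b"
  using nonneg_budgets j by simp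

lemma S_less: "i \<in> S r p \<Longrightarrow> i < n"
  by (auto simp: supporters_def voters_def)

lemma supports_iff:
  assumes "p < m" "i < n"
  shows "supports M n m j r p i \<longleftrightarrow> i \<in> S r p"
proof -
  have "supports M n m j r p i \<longleftrightarrow> (\<exists>q<m. q \<le> r \<and> \<nu> (pref E j i ! q) = \<nu> (cs ! p))"
    using input j assms by (auto simp: supports_def input_ok_def)
  also have "\<dots> \<longleftrightarrow> (\<exists>q<m. q \<le> r \<and> pref E j i ! q = cs ! p)"
    using pref_valid[OF j assms(2)] assms(1) by (metis \<nu>_eq_iff cs_in_cands nth_mem)
  also have "\<dots> \<longleftrightarrow> cs ! p \<in> set (take (Suc r) (pref E j i))"
    using pref_valid(1)[OF j assms(2)] by (auto simp: in_set_conv_nth less_Suc_eq_le)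
  finally show ?thesis using assms(2) by (simp add: supporters_def top_set_def voters_def)
qed

lemma sum_supports:
  assumes "p < m"
  shows "(\<Sum>i<n. if supports M n m j r p i then f i else 0) = sum f (S r p)"
proof -
  have "(\<Sum>i<n. if supports M n m j r p i then f i else 0) = (\<Sum>i<n. if i \<in> S r p then f i else 0)"
    using supports_iff[OF assms] by (intro sum.cong) auto
  also have "\<dots> = sum f {i \<in> {..<n}. i \<in> S r p}"
    by (rule sum.inter_filter[symmetric]) simp
  also have "{i \<in> {..<n}. i \<in> S r p} = S r p"
    using S_less by auto
  finally show ?thesis .
qed

lemma sum_B: "A \<subseteq> S r p \<Longrightarrow> real (sum B A) = sum b A * real D"
proof -
  assume "A \<subseteq> S r p"
  then have "real (B i) = b i * real D" if "i \<in> A" for i using that B[OF S_less] by blast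
  then show ?thesis by (simp add: sum_distrib_right)
qed

lemma can_buy_iff:
  assumes "p < m"
  shows "can_buy M n m T j r p \<longleftrightarrow> cs ! p \<in> purchasable E j b (Suc r)"
proof -
  have "can_buy M n m T j r p \<longleftrightarrow> D \<le> sum B (S r p)"
    by (simp add: can_buy_def D sum_supports[OF assms])
  also have "\<dots> \<longleftrightarrow> real D \<le> real (sum B (S r p))" by (simp only: of_nat_le_iff)
  also have "\<dots> \<longleftrightarrow> 1 \<le> sum b (S r p)"
    using D(1) by (simp only: sum_B[OF order_refl]) (simp add: mult_le_cancel_right1)
  finally show ?thesis using assms by (simp add: purchasable_def)
qed

text \<open>Multiplication by \<open>D > 0\<close> commutes with \<open>min\<close> and turns the
  threshold 1 into \<open>D\<close>.\<close>

lemma is_poor_iff: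
  assumes "p < m" "i < n"
  shows "is_poor M n m T j r p i \<longleftrightarrow> i \<in> poor (S r p) b"
proof -
  have "real (\<Sum>i'\<in>S r p. min (B i) (B i')) = (\<Sum>i'\<in>S r p. min (b i) (b i')) * real D"
    using B[OF S_less] B[OF assms(2)] D(1)
    by (simp add: sum_distrib_right of_nat_min min_mult_distrib_right)
  then have "real (\<Sum>i'\<in>S r p. min (B i) (B i')) < real D \<longleftrightarrow>
      (\<Sum>i'\<in>S r p. min (b i) (b i')) * real D < 1 * real D"
    by (simp only: mult_1)
  then have "(\<Sum>i'\<in>S r p. min (B i) (B i')) < D \<longleftrightarrow> (\<Sum>i'\<in>S r p. min (b i) (b i')) < 1"
    using D(1) by (simp only: of_nat_less_iff mult_less_cancel_right_pos of_nat_0_less_iff)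
  then show ?thesis
    by (simp add: is_poor_def D(2) sum_supports[OF assms(1)] supports_iff[OF assms] poor_def)
qed

lemma poor_subset: "poor (S r p) b \<subseteq> S r p"
  by (auto simp: poor_def)

lemma rho_den_eq:
  assumes "p < m"
  shows "rho_den M n m T j r p = card (S r p - poor (S r p) b)"
proof -
  have "rho_den M n m T j r p = (\<Sum>i<n. if i \<in> S r p - poor (S r p) b then 1 else 0)"
    unfolding rho_den_def using assms by (intro sum.cong refl) (simp add: supports_iff is_poor_iff)
  also have "\<dots> = card {i \<in> {..<n}. i \<in> S r p - poor (S r p) b}"
    by (simp add: sum.inter_filter[symmetric])
  also have "{i \<in> {..<n}. i \<in> S r p - poor (S r p) b} = S r p - poor (S r p) b"
    using S_less by auto
  finally show ?thesis .
qed

lemma rho_den_le: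
  assumes "p < m"
  shows "rho_den M n m T j r p \<le> n"
proof -
  have "card (S r p - poor (S r p) b) \<le> card {..<n}"
    using S_less by (intro card_mono) auto
  then show ?thesis by (simp add: rho_den_eq[OF assms])
qed

lemma rho_den_pos:
  assumes "p < m" "cs ! p \<in> purchasable E j b (Suc r)"
  shows "rho_den M n m T j r p > 0"
  using rich_nonempty[OF purchasable_budgets[OF b assms(2)]]
  by (simp add: rho_den_eq[OF assms(1)] card_gt_0_iff)

text \<open>The truncated subtraction in \<open>rho_num\<close> is exact: what the poor do not cover
  is the price times the number of other supporters, which is not negative.\<close>

lemma rho_num_eq:
  assumes "p < m" "cs ! p \<in> purchasable E j b (Suc r)"
  shows "real (rho_num M n m T j r p) =
    candidate_rho E j b (Suc r) (cs ! p) * real (D * rho_den M n m T j r p)"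
proof -
  let ?P = "poor (S r p) b"
  let ?\<rho> = "candidate_rho E j b (Suc r) (cs ! p)"
  have k: "real (rho_den M n m T j r p) > 0" using rho_den_pos[OF assms] by simp
  have \<rho>: "1 - sum b ?P = ?\<rho> * real (rho_den M n m T j r p)"
    using k unfolding min_rho_def rho_den_eq[OF assms(1)]
    by (simp only: nonzero_divide_eq_eq times_divide_eq_left nonzero_mult_div_cancel_right
        less_irrefl[THEN contrapos_pn] not_False_eq_True less_imp_neq[symmetric])
  have "(\<Sum>i<n. if is_poor M n m T j r p i then B i else 0) = (\<Sum>i<n. if i \<in> ?P then B i else 0)"
    using is_poor_iff[OF assms(1)] by (intro sum.cong) auto
  also have "\<dots> = sum B {i \<in> {..<n}. i \<in> ?P}"
    by (rule sum.inter_filter[symmetric]) simp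
  also have "{i \<in> {..<n}. i \<in> ?P} = ?P"
    using S_less poor_subset by blast
  finally have "rho_num M n m T j r p = D - sum B ?P" by (simp add: rho_num_def D(2))
  moreover have "sum b ?P * real D \<le> 1 * real D"
  proof (rule mult_right_mono)
    have "0 \<le> ?\<rho> * real (rho_den M n m T j r p)"
      using candidate_rho_pos[OF b assms(2)] by simp
    then show "sum b ?P \<le> 1" using \<rho> by linarith
  qed simp
  then have "sum B ?P \<le> D"
    by (simp only: sum_B[OF poor_subset, symmetric] of_nat_le_iff mult_1)
  ultimately have "real (rho_num M n m T j r p) = (1 - sum b ?P) * real D"
    by (simp only: of_nat_diff sum_B[OF poor_subset]) (simp add: algebra_simps)
  then show ?thesis by (simp add: \<rho> mult_ac)
qed

lemma rho_le_iff:
  assumes "p < m" "cs ! p \<in> purchasable E j b (Suc r)" "p' < m" "cs ! p' \<in> purchasable E j b (Suc r)"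
  shows "rho_le M n m T j r p p' \<longleftrightarrow>
    candidate_rho E j b (Suc r) (cs ! p) \<le> candidate_rho E j b (Suc r) (cs ! p')"
proof -
  let ?k = "rho_den M n m T j r p" and ?k' = "rho_den M n m T j r p'"
  have pos: "real (D * ?k * ?k') > 0" using D(1) rho_den_pos[OF assms(1,2)] rho_den_pos[OF assms(3,4)] by simp
  have "rho_le M n m T j r p p' \<longleftrightarrow>
      real (rho_num M n m T j r p * ?k') \<le> real (rho_num M n m T j r p' * ?k)"
    using rho_den_le[OF assms(1), of r] rho_den_le[OF assms(3), of r]
    by (simp only: rho_le_def times_le_eq of_nat_le_iff)
  also have "\<dots> \<longleftrightarrow> candidate_rho E j b (Suc r) (cs ! p) * real (D * ?k * ?k')
      \<le> candidate_rho E j b (Suc r) (cs ! p') * real (D * ?k * ?k')"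
    by (simp only: of_nat_mult rho_num_eq[OF assms(1,2)] rho_num_eq[OF assms(3,4)] mult_ac)
  finally show ?thesis by (simp only: mult_le_cancel_right_pos[OF pos])
qed

lemma ball_purchasable_iff:
  "(\<forall>c\<in>purchasable E j b (Suc r). Q c) \<longleftrightarrow> (\<forall>p<m. can_buy M n m T j r p \<longrightarrow> Q (cs ! p))"
proof
  assume "\<forall>c\<in>purchasable E j b (Suc r). Q c"
  then show "\<forall>p<m. can_buy M n m T j r p \<longrightarrow> Q (cs ! p)" using can_buy_iff by blast
next
  assume *: "\<forall>p<m. can_buy M n m T j r p \<longrightarrow> Q (cs ! p)"
  show "\<forall>c\<in>purchasable E j b (Suc r). Q c"
  proof
    fix c assume c: "c \<in> purchasable E j b (Suc r)"
    then have "c \<in> cands E" by (simp add: purchasable_def)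
    then obtain p where "p < m" "c = cs ! p" using cands_cs by blast
    then show "Q c" using * c can_buy_iff by blast
  qed
qed

lemma purchasable_empty_iff:
  "purchasable E j b (Suc r) = {} \<longleftrightarrow> (\<forall>p<m. \<not> can_buy M n m T j r p)"
  using ball_purchasable_iff[of r "\<lambda>_. False"] by auto

lemma winner_iff:
  assumes "p < m"
  shows "winner tie E j b (Suc r) (cs ! p) \<longleftrightarrow> can_buy M n m T j r p \<and>
    (\<forall>p'<m. can_buy M n m T j r p' \<longrightarrow>
      rho_le M n m T j r p p' \<and> (rho_le M n m T j r p' p \<longrightarrow> p \<le> p'))"
proof (cases "can_buy M n m T j r p")
  case True
  have "rho_le M n m T j r p p' \<longleftrightarrow>
      candidate_rho E j b (Suc r) (cs ! p) \<le> candidate_rho E j b (Suc r) (cs ! p')"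
    "rho_le M n m T j r p' p \<longleftrightarrow>
      candidate_rho E j b (Suc r) (cs ! p') \<le> candidate_rho E j b (Suc r) (cs ! p)"
    "(cs ! p, cs ! p') \<in> tie \<longleftrightarrow> p \<le> p'"
    if "p' < m" "can_buy M n m T j r p'" for p'
    using that True assms by (simp_all only: can_buy_iff rho_le_iff tie_cs_iff)
  then show ?thesis
    using True unfolding winner_def ball_purchasable_iff can_buy_iff[OF assms, symmetric] by blast
qed (simp add: winner_def can_buy_iff[OF assms])

lemma selected_iff:
  assumes "r < m" "p < m"
  shows "selected M n m T j r p \<longleftrightarrow> least_cutoff E j b (Suc r) \<and> winner tie E j b (Suc r) (cs ! p)"
proof -
  \<comment> \<open>The cutoffs below \<open>r + 1\<close> are the successors of the indices below
    \<open>r\<close>.\<close>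
  have "(\<forall>r'\<in>{1..<Suc r}. purchasable E j b r' = {}) \<longleftrightarrow>
      (\<forall>r'\<in>Suc ` {..<r}. purchasable E j b r' = {})"
    by (simp add: image_Suc_lessThan atLeastLessThanSuc_atLeastAtMost)
  also have "\<dots> \<longleftrightarrow> (\<forall>r'<r. purchasable E j b (Suc r') = {})"
    by blast
  also have "\<dots> \<longleftrightarrow> (\<forall>r'<m. r' < r \<longrightarrow> (\<forall>p'<m. \<not> can_buy M n m T j r' p'))"
    unfolding purchasable_empty_iff using less_trans[OF _ assms(1)] by blast
  finally have "selected M n m T j r p \<longleftrightarrow>
      winner tie E j b (Suc r) (cs ! p) \<and> (\<forall>r'\<in>{1..<Suc r}. purchasable E j b r' = {})"
    unfolding selected_def winner_iff[OF assms(2)] by blast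
  then show ?thesis
    using assms(1) unfolding least_cutoff_def winner_def by auto
qed

text \<open>\<open>K\<close> is described by the election and not by the memory, so that all
  memories of the round share it.\<close>

lemma round_result:
  assumes cut: "least_cutoff E j b (Suc r0)" and win: "winner tie E j b (Suc r0) (cs ! p0)"
    and p0: "p0 < m" "chosen tie E j = cs ! p0"
    and pay: "budgets tie E (Suc j) = pay E j b (Suc r0) (cs ! p0)"
    and K_def: "K = card (S r0 p0 - poor (S r0 p0) b)"
  shows "K > 0" "\<And>i. i < n \<Longrightarrow>
      real (next_budget M n m T j i) = budgets tie E (Suc j) i * real (D * K)"
    "next_scale M n m T j = D * K" "next_winner M n m T j = \<nu> (chosen tie E j)"
proof -
  have r0: "r0 < m" using cut by (simp add: least_cutoff_def)
  have p0_buy: "cs ! p0 \<in> purchasable E j b (Suc r0)"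
    using win by (simp add: winner_def)
  have sel: "selected M n m T j r' p' \<longleftrightarrow> r' = r0 \<and> p' = p0" if "r' < m" "p' < m" for r' p'
  proof -
    have "least_cutoff E j b (Suc r') \<longleftrightarrow> r' = r0"
      using least_cutoff_unique[OF cut, of "Suc r'"] cut by (metis Suc_inject)
    moreover have "winner tie E j b (Suc r0) (cs ! p') \<longleftrightarrow> p' = p0"
      using winner_unique[OF tie win, of "cs ! p'"] win cs_nth_eq_iff[OF p0(1) that(2)] by metis
    ultimately show ?thesis unfolding selected_iff[OF that] by metis
  qed
  note at = at_selected_eq[OF r0 p0(1) sel]
  have K_eq: "rho_den M n m T j r0 p0 = K" by (simp add: K_def rho_den_eq[OF p0(1)])
  define \<rho> where "\<rho> = candidate_rho E j b (Suc r0) (cs ! p0)"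
  show K: "K > 0" using rho_den_pos[OF p0(1) p0_buy] by (simp only: K_eq)
  have K_le: "K \<le> n" using rho_den_le[OF p0(1), of r0] by (simp only: K_eq)
  have N: "real (rho_num M n m T j r0 p0) = \<rho> * real (D * K)"
    using rho_num_eq[OF p0(1) p0_buy] by (simp only: \<rho>_def K_eq)
  show "real (next_budget M n m T j i) = budgets tie E (Suc j) i * real (D * K)" if i: "i < n" for i
  proof (cases "i \<in> S r0 p0")
    case False
    then have "next_budget M n m T j i = B i * K"
      using i K_le by (simp add: next_budget_def at supports_iff[OF p0(1)] K_eq times_le_eq)
    moreover have "budgets tie E (Suc j) i = b i"
      unfolding pay pay_def using False by simp
    ultimately show ?thesis using B[OF i] by simp
  next
    case True
    then have eq: "next_budget M n m T j i = B i * K - rho_num M n m T j r0 p0"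
      using i K_le by (simp add: next_budget_def at supports_iff[OF p0(1)] K_eq times_le_eq)
    have DK: "real (D * K) > 0" using D(1) K by simp
    have BK: "real (B i * K) = b i * real (D * K)" using B[OF i] by simp
    have pay': "budgets tie E (Suc j) i = b i - min \<rho> (b i)"
      unfolding pay pay_def using True by (simp add: \<rho>_def)
    have le: "rho_num M n m T j r0 p0 \<le> B i * K \<longleftrightarrow> \<rho> \<le> b i"
      using DK by (simp only: of_nat_le_iff[symmetric, where 'a = real] N BK mult_le_cancel_right_pos)
    show ?thesis
    proof (cases "\<rho> \<le> b i")
      case True
      then have "real (next_budget M n m T j i) = b i * real (D * K) - \<rho> * real (D * K)"
        using le by (simp only: eq of_nat_diff BK N)
      then show ?thesis using True by (simp only: pay' min_def if_True left_diff_distrib)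
    next
      case False
      \<comment> \<open>This supporter cannot afford the price and gives everything, which is where
        the subtraction truncates.\<close>
      then have "next_budget M n m T j i = 0" using le by (simp add: eq)
      then show ?thesis using False by (simp add: pay' del: budgets.simps)
    qed
  qed
  show "next_scale M n m T j = D * K"
    using K_le by (simp add: next_scale_def at K_eq times_le_eq D(2))
  show "next_winner M n m T j = \<nu> (chosen tie E j)"
    using input p0 by (simp add: next_winner_def at input_ok_def)
qed

end

context mes_instance
begin

text \<open>
  The memory changes while a row is written; all cells of the row get the same denominator because
  \<open>K\<close> is independent of the memory.
\<close>

lemma round_factor:
  assumes j: "j < T"
  shows "\<exists>K>0. \<forall>M D. input_ok M \<longrightarrow> row_ok M j D \<longrightarrow>
    (\<forall>i<n. real (next_budget M n m T j i) = budgets tie E (Suc j) i * real (D * K)) \<and>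
    next_scale M n m T j = D * K \<and> next_winner M n m T j = \<nu> (chosen tie E j)"
proof -
  let ?b = "budgets tie E j"
  have b: "nonneg_budgets E ?b" using nonneg_budgets j by simp
  obtain r where cut: "least_cutoff E j ?b r" and win: "winner tie E j ?b r (chosen tie E j)"
    and pay: "budgets tie E (Suc j) = pay E j ?b r (chosen tie E j)"
    using mes_round[OF j] unfolding mes_round_iff[OF b] by blast
  obtain r0 where r0: "r = Suc r0"
    using cut by (cases r) (auto simp: least_cutoff_def)
  obtain p0 where p0: "p0 < m" "chosen tie E j = cs ! p0"
    using cands_cs[OF chosen_in_cands[OF j]] by blast
  let ?S = "supporters E j (cs ! p0) (Suc r0)"
  let ?K = "card (?S - poor ?S ?b)"
  have "?S - poor ?S ?b \<noteq> {}"
    using win by (intro rich_nonempty purchasable_budgets[OF b]) (auto simp: winner_def r0 p0(2))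
  then have "?K > 0" by (simp only: card_gt_0_iff) simp
  moreover have "(\<forall>i<n. real (next_budget M n m T j i) = budgets tie E (Suc j) i * real (D * ?K)) \<and>
      next_scale M n m T j = D * ?K \<and> next_winner M n m T j = \<nu> (chosen tie E j)"
    if "input_ok M" "row_ok M j D" for M D
  proof -
    interpret mes_row tie E cs \<nu> M j D using that j by unfold_locales
    show ?thesis
      using round_result(2-4)[OF cut[unfolded r0] win[unfolded r0 p0(2)] p0 pay[unfolded r0 p0(2)] refl]
      by blast
  qed
  ultimately show ?thesis by blast
qed

definition state_ok :: "(nat \<Rightarrow> nat) \<Rightarrow> nat \<Rightarrow> bool" where
  "state_ok M j \<longleftrightarrow> input_ok M \<and> (\<exists>D. row_ok M j D) \<and>
     (\<forall>k<j. M (row_cell n m T (Suc k) (n + 1)) = \<nu> (chosen tie E k))"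

lemma input_ok_cong:
  assumes "input_ok M" "\<forall>a<row_cell n m T j 0. M' a = M a"
  shows "input_ok M'"
proof -
  have "M' a = M a" if "a < 3 + m + T * (n * m)" for a
    using assms(2) input_cell_less_row_cell[OF that] by blast
  then show ?thesis
    using assms(1) pref_cell_less unfolding input_ok_def by simp
qed

lemma row_ok_cong:
  assumes "row_ok M j D" "\<forall>a<row_cell n m T (Suc j) 0. M' a = M a"
  shows "row_ok M' j D"
  using assms row_cell_less[of j "Suc j"] by (simp add: row_ok_def)

lemma init_row_ok:
  assumes "input_ok M"
  shows "state_ok (init_row n m T M) 0"
proof -
  define M1 where "M1 = fold (\<lambda>i M. M(row_cell n m T 0 i := T)) [0..<n] M"
  have "(\<forall>a<row_cell n m T 0 0. M1 a = M a) \<and> (\<forall>i<n. M1 (row_cell n m T 0 i) = T)"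
    unfolding M1_def
    by (rule fold_upt_invariant[where I = "\<lambda>k M'. (\<forall>a<row_cell n m T 0 0. M' a = M a) \<and>
          (\<forall>i<k. M' (row_cell n m T 0 i) = T)"])
      (auto simp: less_Suc_eq row_cell_def)
  moreover have "init_row n m T M = M1(row_cell n m T 0 n := n)"
    by (simp only: init_row_def M1_def)
  ultimately have M1: "\<forall>a<row_cell n m T 0 0. (init_row n m T M) a = M a"
    "\<forall>i<n. init_row n m T M (row_cell n m T 0 i) = T"
    "init_row n m T M (row_cell n m T 0 n) = n"
    by (auto simp: row_cell_def)
  have "n > 0" using valid by (simp add: valid_election_def)
  then have "row_ok (init_row n m T M) 0 n" using M1 by (simp add: row_ok_def)
  then show ?thesis using input_ok_cong[OF assms M1(1)] by (auto simp: state_ok_def)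
qed

lemma round_ok:
  assumes j: "j < T" and M: "state_ok M j"
  shows "state_ok (round_winner n m T j (round_scale n m T j (round_budgets n m T j M))) (Suc j)"
proof -
  let ?row = "row_cell n m T (Suc j)"
  obtain D where input: "input_ok M" and row: "row_ok M j D"
    and old: "\<And>k. k < j \<Longrightarrow> M (row_cell n m T (Suc k) (n + 1)) = \<nu> (chosen tie E k)"
    using M unfolding state_ok_def by blast
  obtain K where K: "K > 0"
    "\<And>M D i. input_ok M \<Longrightarrow> row_ok M j D \<Longrightarrow> i < n \<Longrightarrow>
      real (next_budget M n m T j i) = budgets tie E (Suc j) i * real (D * K)"
    "\<And>M D. input_ok M \<Longrightarrow> row_ok M j D \<Longrightarrow> next_scale M n m T j = D * K"
    "\<And>M D. input_ok M \<Longrightarrow> row_ok M j D \<Longrightarrow> next_winner M n m T j = \<nu> (chosen tie E j)"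
    using round_factor[OF j] by blast
  \<comment> \<open>Agreement with the old memory below the row being written. Every write of the
    round preserves it, and it keeps the input and row \<open>j\<close> valid, so the facts on
    \<open>K\<close> apply to each intermediate memory.\<close>
  define same where "same M' \<longleftrightarrow> (\<forall>a<?row 0. M' a = M a)" for M'
  have same_upd: "same (M'(?row x := v))" if "same M'" for M' x v
    using that by (auto simp: same_def row_cell_def)
  have ok: "input_ok M'" "row_ok M' j D" if "same M'" for M'
    using input_ok_cong[OF input] row_ok_cong[OF row] that by (auto simp: same_def)
  define M1 where "M1 = round_budgets n m T j M"
  define M2 where "M2 = round_scale n m T j M1"
  define M3 where "M3 = round_winner n m T j M2"
  have M1: "same M1 \<and> (\<forall>i<n. real (M1 (?row i)) = budgets tie E (Suc j) i * real (D * K))"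
    unfolding M1_def round_budgets_def
  proof (rule fold_upt_invariant[where I = "\<lambda>k M'. same M' \<and>
        (\<forall>i<k. real (M' (?row i)) = budgets tie E (Suc j) i * real (D * K))"])
    show "same M \<and> (\<forall>i<0. real (M (?row i)) = budgets tie E (Suc j) i * real (D * K))"
      by (simp add: same_def)
  next
    fix i M'
    assume "i < n"
      and *: "same M' \<and> (\<forall>i'<i. real (M' (?row i')) = budgets tie E (Suc j) i' * real (D * K))"
    then have "real (next_budget M' n m T j i) = budgets tie E (Suc j) i * real (D * K)"
      using K(2) ok by blast
    then show "same (M'(?row i := next_budget M' n m T j i)) \<and>
        (\<forall>i'<Suc i. real ((M'(?row i := next_budget M' n m T j i)) (?row i')) =
          budgets tie E (Suc j) i' * real (D * K))"
      using * same_upd by (auto simp: less_Suc_eq simp del: of_nat_mult budgets.simps)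
  qed
  then have M2: "M2 = M1(?row n := D * K)" "same M2"
    using K(3)[OF ok] same_upd by (auto simp: M2_def round_scale_def)
  then have M3: "M3 = M2(?row (n + 1) := \<nu> (chosen tie E j))" "same M3"
    using K(4)[OF ok] same_upd by (auto simp: M3_def round_winner_def)
  have "row_ok M3 (Suc j) (D * K)"
    using M1 K(1) row unfolding row_ok_def M3 M2 by (simp del: of_nat_mult budgets.simps)
  moreover have "M3 (row_cell n m T (Suc k) (n + 1)) = \<nu> (chosen tie E k)" if "k < Suc j" for k
  proof (cases "k = j")
    case False
    then have "row_cell n m T (Suc k) (n + 1) < ?row 0"
      using that by (intro row_cell_less) auto
    then show ?thesis using M3(2) old[of k] False that by (simp add: same_def)
  qed (simp add: M3)
  ultimately have "state_ok M3 (Suc j)"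
    using ok(1)[OF M3(2)] by (auto simp: state_ok_def)
  then show ?thesis by (simp add: M1_def M2_def M3_def)
qed

lemma mes_program_correct:
  assumes "input_ok M" "j < T"
  shows "mes_program n m T M j = \<nu> (mes tie E ! j)"
proof -
  define M1 where "M1 = all_rounds n m T (init_row n m T M)"
  have "state_ok M1 T"
    unfolding M1_def all_rounds_def
    by (rule fold_upt_invariant[where I = "\<lambda>j M. state_ok M j"])
      (auto intro: init_row_ok[OF assms(1)] round_ok)
  then have M1: "M1 (row_cell n m T (Suc k) (n + 1)) = \<nu> (chosen tie E k)" if "k < T" for k
    using that by (simp add: state_ok_def)
  \<comment> \<open>The rows begin behind at least \<open>T\<close> cells because
    \<open>n * m\<close> is positive, so the output does not overwrite a winner still to be
    copied.\<close>
  have "n > 0" "m > 0" using valid by (auto simp: valid_election_def card_gt_0_iff)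
  then have "1 \<le> n * m" by (simp add: Suc_le_eq)
  from mult_le_mono2[OF this, of T] have row: "T \<le> row_cell n m T k x" for k x
    unfolding row_cell_def by linarith
  have "(\<forall>a\<ge>T. write_output n m T M1 a = M1 a) \<and> (\<forall>k<T. write_output n m T M1 k = \<nu> (chosen tie E k))"
    unfolding write_output_def
    by (rule fold_upt_invariant[where I = "\<lambda>k M'. (\<forall>a\<ge>T. M' a = M1 a) \<and> (\<forall>i<k. M' i = \<nu> (chosen tie E i))"])
      (use M1 row in \<open>auto simp: less_Suc_eq\<close>)
  then show ?thesis using assms(2) by (simp add: mes_program_def M1_def mes_eq)
qed

lemma encode_correct:
  shows "length (encode \<nu> cs E) = 3 + m + T * (n * m)" "input_ok (snd (input_state (encode \<nu> cs E)))"
proof -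
  let ?f = "\<lambda>j. concat (map (\<lambda>i. map \<nu> (pref E j i)) [0..<n])"
  let ?prefs = "concat (map ?f [0..<T])"
  have len1: "length (?f j) = n * m" if "j < T" for j
    using pref_valid(1)[OF that] by (intro length_concat_map_upt) simp
  then have len2: "length ?prefs = T * (n * m)"
    by (rule length_concat_map_upt)
  show len: "length (encode \<nu> cs E) = 3 + m + T * (n * m)"
    unfolding encode_def length_append len2 by simp
  have "encode \<nu> cs E ! (3 + p) = \<nu> (cs ! p)" if "p < m" for p
    using that by (simp add: encode_def nth_append)
  moreover have "encode \<nu> cs E ! pref_cell n m j i q = \<nu> (pref E j i ! q)"
    if "j < T" "i < n" "q < m" for j i q
  proof -
    have "Suc i * m \<le> n * m" using that by (intro mult_le_mono1) simp
    then have less: "i * m + q < n * m" using that(3) by simp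
    have "encode \<nu> cs E ! pref_cell n m j i q = ?prefs ! (j * (n * m) + (i * m + q))"
      by (simp add: encode_def pref_cell_def nth_append)
    also have "\<dots> = ?f j ! (i * m + q)"
      by (rule nth_concat_map_upt[OF len1 that(1) less])
    also have "\<dots> = map \<nu> (pref E j i) ! q"
      using pref_valid(1)[OF that(1)] by (intro nth_concat_map_upt that) simp
    finally show ?thesis using pref_valid(1)[OF that(1,2)] that(3) by simp
  qed
  ultimately show "input_ok (snd (input_state (encode \<nu> cs E)))"
    using len pref_cell_less unfolding input_ok_def input_state_def by simp
qed

lemma encode_nth [simp]:
  "encode \<nu> cs E ! 0 = n" "encode \<nu> cs E ! Suc 0 = m" "encode \<nu> cs E ! 2 = T"
  by (simp_all add: encode_def)

end

section \<open>Polynomial time and conclusion\<close>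

lemma polynomial_time_mes:
  fixes tie :: "'c rel"
  assumes "linear_order tie"
  shows "polynomial_time tie (mes tie)"
  unfolding polynomial_time_def
proof (rule polytime_computableI[OF computable_mes_program[of 0 1 2]])
  fix xs ys
  assume "(xs, ys) \<in> {(encode \<nu> cs E, map \<nu> (mes tie E)) | \<nu> cs E.
    valid_election E \<and> lists_in_order tie (cands E) cs \<and> bij_betw \<nu> (cands E) {..<card (cands E)}}"
  then obtain \<nu> cs E where E: "valid_election E" "lists_in_order tie (cands E) cs"
    "bij_betw \<nu> (cands E) {..<card (cands E)}"
    and xs: "xs = encode \<nu> cs E" and ys: "ys = map \<nu> (mes tie E)" by blast
  interpret mes_instance tie E cs \<nu> using E assms by unfold_locales
  have pos: "n > 0" "m > 0" "T > 0" using valid by (auto simp: valid_election_def card_gt_0_iff)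
  \<comment> \<open>The rankings alone occupy \<open>T * n * m\<close> words with all factors
    positive, so \<open>n\<close> and \<open>T\<close>, though given in binary, do not exceed the
    input length.\<close>
  then have "1 \<le> T * m" "1 \<le> n * m" by (simp_all add: Suc_le_eq)
  then have "n * 1 \<le> n * (T * m)" "T * 1 \<le> T * (n * m)" by (simp_all only: mult_le_mono2)
  then have "3 \<le> length xs \<and> n \<le> length xs \<and> m \<le> length xs \<and> T \<le> length xs"
    unfolding xs encode_correct(1) mult.left_commute[of n] by linarith
  moreover have "ys = map (mes_program n m T (snd (input_state xs))) [0..<T]"
    unfolding ys by (rule nth_equalityI) (auto simp: mes_eq xs mes_program_correct encode_correct(2))
  ultimately show "length xs \<ge> 3 \<and> xs ! 0 \<le> length xs \<and> xs ! 1 \<le> length xs \<and> xs ! 2 \<le> length xs \<and>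
      ys = map (mes_program (if (0::nat) = 0 then xs ! 0 else if (0::nat) = 1 then xs ! 1 else xs ! 2)
        (if (1::nat) = 0 then xs ! 0 else if (1::nat) = 1 then xs ! 1 else xs ! 2)
        (if (2::nat) = 0 then xs ! 0 else if (2::nat) = 1 then xs ! 1 else xs ! 2)
        (snd (input_state xs))) [0..<xs ! 2]"
    by (simp add: xs)
qed

text \<open>Unique existence of the outcome ensures that the \<open>THE\<close> in
  \<open>mes\<close> denotes the sequence chosen by the rule.\<close>

theorem theorem4p4:
  fixes tie :: "'c rel"
  assumes "linear_order tie"
  shows "(\<forall>E. valid_election E \<longrightarrow> (\<exists>!W. mes_outcome tie E W)) \<and>
    polynomial_time tie (mes tie) \<and>
    semi_online (mes tie) \<and>
    (\<forall>E. valid_election E \<longrightarrow> rank_wPJR E (mes tie E))"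
proof (intro conjI allI impI polynomial_time_mes semi_online_mes assms)
  fix E :: "'c election" assume "valid_election E"
  then interpret mes_election tie E using assms by unfold_locales
  show "\<exists>!W. mes_outcome tie E W" by (simp add: mes_outcome_iff)
  show "rank_wPJR E (mes tie E)" by (rule rank_wPJR_mes)
qed

end
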